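(* Let $X$ be a dyadic compactum. Then $\pi Nt(X)=\chi_K Nt(X)=\omega$. Moreover, if $X$ is homogeneous, then $Nt(X)=\omega$.
   Context: A compactum is a compact Hausdorff space; a dyadic compactum is a Hausdorff continuous image of $2^\kappa$ for some cardinal $\kappa$. Families of subsets of a space are ordered by inclusion. For a cardinal $\kappa$, a poset is $\kappa^{\mathrm{op}}$-like if no element is below $\kappa$-many elements (i.e. for each $p$, the set $\{q: q\geq p\}$ has size $<\kappa$). The Noetherian type $Nt(X)$ is the least $\kappa\geq\omega$ such that $X$ has a $\kappa^{\mathrm{op}}$-like base; the Noetherian $\pi$-type $\pi Nt(X)$ is the least $\kappa\geq\omega$ such that $X$ has a $\kappa^{\mathrm{op}}$-like $\pi$-base. For $E\subseteq X$, the local Noetherian type $\chi Nt(E,X)$ is the least $\kappa\geq\omega$ such that $E$ has a $\kappa^{\mathrm{op}}$-like neighborhood base (a family of open sets containing $E$ such that every open set containing $E$ contains a member). The compact Noetherian type $\chi_K Nt(X)$ is the supremum of $\chi Nt(K,X)$ over all compact $K\subseteq X$. *)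

theory Defs
  imports "HOL-Analysis.Analysis"
begin

definition cantor_cube :: "'i set \<Rightarrow> ('i \<Rightarrow> bool) topology" where
  "cantor_cube I = product_topology (\<lambda>i. discrete_topology (UNIV :: bool set)) I"

definition dyadic_compactum_via :: "'i set \<Rightarrow> (('i \<Rightarrow> bool) \<Rightarrow> 'a) \<Rightarrow> 'a topology \<Rightarrow> bool" where
  "dyadic_compactum_via I f X \<longleftrightarrow>
     compact_space X \<and> Hausdorff_space X \<and>
     continuous_map (cantor_cube I) X f \<and> f ` topspace (cantor_cube I) = topspace X"

text \<open>kappa^op-like family (ordered by inclusion): no member is contained in
  kappa-many members. Cardinals are represented by cardinal orders; kappa = omega is natLeq.\<close>
definition op_like :: "'b rel \<Rightarrow> 'a set set \<Rightarrow> bool" where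
  "op_like \<kappa> F \<longleftrightarrow> (\<forall>p\<in>F. (card_of {q\<in>F. p \<subseteq> q}, \<kappa>) \<in> ordLess)"

definition is_base :: "'a topology \<Rightarrow> 'a set set \<Rightarrow> bool" where
  "is_base X B \<longleftrightarrow> (\<forall>U\<in>B. openin X U) \<and>
     (\<forall>U. openin X U \<longrightarrow> (\<forall>x\<in>U. \<exists>V\<in>B. x \<in> V \<and> V \<subseteq> U))"

definition is_pi_base :: "'a topology \<Rightarrow> 'a set set \<Rightarrow> bool" where
  "is_pi_base X B \<longleftrightarrow> (\<forall>U\<in>B. openin X U \<and> U \<noteq> {}) \<and>
     (\<forall>U. openin X U \<and> U \<noteq> {} \<longrightarrow> (\<exists>V\<in>B. V \<subseteq> U))"

definition is_nbhd_base :: "'a topology \<Rightarrow> 'a set \<Rightarrow> 'a set set \<Rightarrow> bool" where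
  "is_nbhd_base X E B \<longleftrightarrow> (\<forall>U\<in>B. openin X U \<and> E \<subseteq> U) \<and>
     (\<forall>U. openin X U \<and> E \<subseteq> U \<longrightarrow> (\<exists>V\<in>B. V \<subseteq> U))"

text \<open>Since these invariants are defined as the least kappa >= omega admitting a
  kappa^op-like family (and omega^op-like implies kappa^op-like for kappa >= omega),
  each invariant equals omega iff an omega^op-like family of the relevant kind exists.\<close>
definition Nt_eq_omega :: "'a topology \<Rightarrow> bool" where
  "Nt_eq_omega X \<longleftrightarrow> (\<exists>B. is_base X B \<and> op_like natLeq B)"

definition piNt_eq_omega :: "'a topology \<Rightarrow> bool" where
  "piNt_eq_omega X \<longleftrightarrow> (\<exists>B. is_pi_base X B \<and> op_like natLeq B)"

definition chiNt_eq_omega :: "'a topology \<Rightarrow> 'a set \<Rightarrow> bool" where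
  "chiNt_eq_omega X E \<longleftrightarrow> (\<exists>B. is_nbhd_base X E B \<and> op_like natLeq B)"

text \<open>chi_K Nt(X) = sup of chiNt(K,X) over compact K; it equals omega iff each term does.\<close>
definition chiKNt_eq_omega :: "'a topology \<Rightarrow> bool" where
  "chiKNt_eq_omega X \<longleftrightarrow> (\<forall>K. compactin X K \<longrightarrow> chiNt_eq_omega X K)"

definition homogeneous_space :: "'a topology \<Rightarrow> bool" where
  "homogeneous_space X \<longleftrightarrow>
     (\<forall>x\<in>topspace X. \<forall>y\<in>topspace X. \<exists>h. homeomorphic_map X X h \<and> h x = y)"

end

theory Submission
  imports Defs
begin

text \<open>
  Compose \<open>f\<close> with restriction to \<open>I\<close> to get a map \<open>g\<close> from the Cantor cube on the whole index type onto \<open>X\<close>.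
  If \<open>cl U \<subseteq> V\<close> in \<open>X\<close>, compactness puts a clopen set of finite support between the preimages of \<open>U\<close>
  and \<open>V\<close>. Clopen sets interpolate (the Freese--Nation property): if \<open>e \<subseteq> d\<close> have supports \<open>S\<close> and \<open>F\<close>, some
  clopen set with support \<open>S \<inter> F\<close> lies between them. Hence families built by transfinite recursion are
  \<open>\<omega>\<close>-op-like provided that the member chosen at stage \<open>t\<close> has no subset of the form \<open>e\<close>, where the clopen set
  \<open>e\<close> is supported by the coordinates of earlier stages and contains the preimage of an admissible open set:
  a set with finite support \<open>S\<close> lies below members of stage \<open>t\<close> only if \<open>t\<close> is the first
  stage to use some coordinate in \<open>S\<close>. Such choices exist when the recursion has
  length the least cardinality of a neighbourhood base of \<open>K\<close>, or of a \<open>\<pi>\<close>-base of an open set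
  on which this cardinality is hereditarily constant.

  For a base one needs that all points have \<open>\<pi>\<close>-character equal to the weight. In the homogeneous case let
  \<open>\<lambda>\<close> be the common \<open>\<pi>\<close>-character. Taking limits of points in a local \<open>\<pi>\<close>-base shows that every fibre of \<open>g\<close>
  contains a cube obtained by fixing \<open>\<lambda>\<close> coordinates. As \<open>\<lambda>\<^sup>+\<close> is a caliber of Cantor cubes, a chain of length
  \<open>\<lambda>\<^sup>+\<close> yields one set of \<open>\<lambda>\<close> coordinates that works for all points, and so a base of
  cardinality \<open>\<lambda>\<close>.
\<close>

unbundle cardinal_syntax

section \<open>Cardinalities\<close>

lemma card_of_finite_ordLess_infinite: "\<lbrakk>finite A; infinite L\<rbrakk> \<Longrightarrow> |A| <o |L|"
  using finite_ordLess_infinite[OF card_of_Well_order card_of_Well_order] by (simp add: Field_card_of)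

lemma card_of_finite_ordLeq_infinite: "\<lbrakk>finite A; infinite L\<rbrakk> \<Longrightarrow> |A| \<le>o |L|"
  using card_of_finite_ordLess_infinite ordLess_imp_ordLeq by blast

text \<open>Induction on the size \<open>n\<close>: a set of size \<open>Suc n\<close> arises by
  inserting a point into one of size \<open>n\<close>. The countable union over \<open>n\<close>
  does not exceed the infinite cardinal \<open>|A|\<close>.\<close>

lemma card_of_Fpow_ordLeq:
  assumes "infinite A"
  shows "|Fpow A| \<le>o |A|"
proof -
  have "|{B. B \<subseteq> A \<and> finite B \<and> card B = n}| \<le>o |A|" for n
  proof (induction n)
    case 0
    have "{B. B \<subseteq> A \<and> finite B \<and> card B = 0} \<subseteq> {{}}" by auto
    then show ?case
      using card_of_finite_ordLeq_infinite[OF _ assms] finite_subset by blast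
  next
    case (Suc n)
    let ?S = "\<lambda>n. {B. B \<subseteq> A \<and> finite B \<and> card B = n}"
    have "?S (Suc n) \<subseteq> (\<lambda>(a, B). insert a B) ` (A \<times> ?S n)"
    proof
      fix B assume "B \<in> ?S (Suc n)"
      then obtain a C where "B = insert a C" "a \<notin> C" "card C = n" "finite C" "B \<subseteq> A"
        by (auto simp: card_Suc_eq)
      then show "B \<in> (\<lambda>(a, B). insert a B) ` (A \<times> ?S n)"
        by (intro image_eqI[of _ _ "(a, C)"]) auto
    qed
    then have "|?S (Suc n)| \<le>o |(\<lambda>(a, B). insert a B) ` (A \<times> ?S n)|"
      by (rule card_of_mono1)
    also have "|(\<lambda>(a, B). insert a B) ` (A \<times> ?S n)| \<le>o |A \<times> ?S n|"
      by (rule card_of_image)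
    also have "|A \<times> ?S n| \<le>o |A|"
      using assms Suc card_of_mono1[OF subset_refl]
      by (intro card_of_Times_ordLeq_infinite_Field card_of_Card_order) (simp_all add: Field_card_of)
    finally show ?case .
  qed
  then have "|\<Union>n\<in>(UNIV::nat set). {B. B \<subseteq> A \<and> finite B \<and> card B = n}| \<le>o |A|"
    using assms infinite_iff_card_of_nat by (intro card_of_UNION_ordLeq_infinite) auto
  moreover have "Fpow A = (\<Union>n\<in>(UNIV::nat set). {B. B \<subseteq> A \<and> finite B \<and> card B = n})"
    by (auto simp: Fpow_def)
  ultimately show ?thesis by simp
qed

text \<open>\<open>ordLess\<close> is well-founded. Such minima are the cardinal invariants along
  which the recursions run.\<close>

lemma ex_minimal_card:
  fixes Q :: "'b set \<Rightarrow> bool"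
  assumes "Q A"
  shows "\<exists>B. Q B \<and> (\<forall>C. Q C \<longrightarrow> |B| \<le>o |C| )"
proof -
  have "wf (inv_image (ordLess :: ('b rel \<times> 'b rel) set) card_of)"
    by (intro wf_inv_image wf_ordLess)
  moreover have "A \<in> Collect Q" using assms by simp
  ultimately obtain B where "B \<in> Collect Q"
    "\<And>C. (C, B) \<in> inv_image ordLess card_of \<Longrightarrow> C \<notin> Collect Q"
    by (metis wfE_min)
  then show ?thesis
    by (intro exI[of _ B]) (auto simp: not_ordLess_iff_ordLeq[OF card_of_Well_order card_of_Well_order, symmetric])
qed

lemma op_like_natLeq: "op_like natLeq B \<longleftrightarrow> (\<forall>p\<in>B. finite {q\<in>B. p \<subseteq> q})"
  by (simp add: op_like_def finite_iff_ordLess_natLeq)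

section \<open>Agreement on coordinate sets\<close>

definition agree :: "'i set \<Rightarrow> ('i \<Rightarrow> bool) \<Rightarrow> ('i \<Rightarrow> bool) \<Rightarrow> bool" where
  "agree J x y \<longleftrightarrow> (\<forall>i\<in>J. x i = y i)"

text \<open>For finite \<open>J\<close> these are the clopen sets of the cube with support in
  \<open>J\<close>.\<close>

definition saturated :: "'i set \<Rightarrow> ('i \<Rightarrow> bool) set \<Rightarrow> bool" where
  "saturated J e \<longleftrightarrow> (\<forall>x y. agree J x y \<longrightarrow> x \<in> e \<longrightarrow> y \<in> e)"

lemma agree_refl [simp]: "agree J x x"
  by (simp add: agree_def)

lemma agree_sym: "agree J x y \<Longrightarrow> agree J y x"
  by (simp add: agree_def)

lemma agree_trans: "agree J x y \<Longrightarrow> agree J y z \<Longrightarrow> agree J x z"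
  by (simp add: agree_def)

lemma agree_mono: "agree J x y \<Longrightarrow> G \<subseteq> J \<Longrightarrow> agree G x y"
  by (auto simp: agree_def)

lemma saturated_mono: "saturated G e \<Longrightarrow> G \<subseteq> J \<Longrightarrow> saturated J e"
  by (meson saturated_def agree_mono)

text \<open>\<open>e\<close> is recovered from the traces of its points on \<open>G\<close>, so it
  corresponds to a set of subsets of \<open>G\<close>.\<close>

lemma finite_saturated:
  assumes "finite G"
  shows "finite {e. saturated G e}"
proof (rule finite_subset)
  show "{e. saturated G e} \<subseteq> (\<lambda>K. {x. {i\<in>G. x i} \<in> K}) ` Pow (Pow G)"
  proof
    fix e assume e: "e \<in> {e. saturated G e}"
    have "x \<in> e" if "{i \<in> G. x i} = {i \<in> G. y i}" "y \<in> e" for x y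
    proof -
      have "agree G y x" using that(1) by (auto simp: agree_def)
      then show ?thesis using e that(2) by (auto simp: saturated_def)
    qed
    then have "e = {x. {i\<in>G. x i} \<in> (\<lambda>x. {i\<in>G. x i}) ` e}" by auto
    then show "e \<in> (\<lambda>K. {x. {i\<in>G. x i} \<in> K}) ` Pow (Pow G)" by blast
  qed
qed (use assms in simp)

text \<open>Bounds the clopen sets supported by coordinates of earlier stages: each involves only
  finitely many stages. For finite \<open>S\<close> the family is finite, which suffices even when
  \<open>T\<close> is countable.\<close>

lemma card_of_saturated_ordLess:
  fixes F :: "'s \<Rightarrow> 'i set"
  assumes T: "infinite T" and S: "|S| <o |T|" and F: "\<And>s. s \<in> S \<Longrightarrow> finite (F s)"
  shows "|{e. \<exists>G. G \<subseteq> (\<Union>s\<in>S. F s) \<and> finite G \<and> saturated G e}| <o |T|"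
proof -
  let ?E = "{e. \<exists>G. G \<subseteq> (\<Union>s\<in>S. F s) \<and> finite G \<and> saturated G e}"
  let ?D = "\<Union>B\<in>Fpow S. {e. saturated (\<Union>s\<in>B. F s) e}"
  have "?E \<subseteq> ?D"
  proof
    fix e assume "e \<in> ?E"
    then obtain G where G: "G \<subseteq> (\<Union>s\<in>S. F s)" "finite G" "saturated G e" by auto
    obtain B where "B \<subseteq> S" "finite B" "G \<subseteq> (\<Union>s\<in>B. F s)"
      using finite_subset_Union[OF G(2), of "F ` S"] G(1) by (metis finite_subset_image)
    then show "e \<in> ?D"
      using saturated_mono[OF G(3)] by (auto simp: Fpow_def)
  qed
  then have le: "|?E| \<le>o |?D|" by (rule card_of_mono1)
  have fin: "finite {e. saturated (\<Union>s\<in>B. F s) e}" if "B \<in> Fpow S" for B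
    using that F by (intro finite_saturated) (auto simp: Fpow_def)
  have "|?D| <o |T|"
  proof (cases "finite S")
    case True
    then have "finite ?D" using fin by (auto simp: Fpow_def)
    then show ?thesis using card_of_finite_ordLess_infinite T by blast
  next
    case False
    then have "|?D| \<le>o |S|"
      using fin card_of_Fpow_ordLeq card_of_finite_ordLeq_infinite
      by (intro card_of_UNION_ordLeq_infinite) auto
    then show ?thesis using S ordLeq_ordLess_trans by blast
  qed
  then show ?thesis using le ordLeq_ordLess_trans by blast
qed

section \<open>Topology of the Cantor cube in terms of finite supports\<close>

lemma topspace_cantor_cube_UNIV [simp]: "topspace (cantor_cube UNIV) = UNIV"
  by (simp add: cantor_cube_def)

lemma openin_cantor_cube_UNIV:
  "openin (cantor_cube UNIV) S \<longleftrightarrow> (\<forall>x\<in>S. \<exists>F. finite F \<and> (\<forall>y. agree F x y \<longrightarrow> y \<in> S))"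
  (is "?L \<longleftrightarrow> ?R")
proof
  assume ?L
  show ?R
  proof
    fix x assume "x \<in> S"
    with \<open>?L\<close> obtain U where U: "finite {i. U i \<noteq> UNIV}" "x \<in> Pi\<^sub>E UNIV U" "Pi\<^sub>E UNIV U \<subseteq> S"
      unfolding cantor_cube_def openin_product_topology_alt by fastforce
    have "y \<in> S" if "agree {i. U i \<noteq> UNIV} x y" for y
    proof -
      have "x i \<in> U i" for i using U(2) by (simp add: PiE_iff)
      moreover have "U i \<noteq> UNIV \<Longrightarrow> x i = y i" for i using that by (simp add: agree_def)
      ultimately have "y i \<in> U i" for i
      proof (cases "U i = UNIV")
        case False
        then show ?thesis using \<open>U i \<noteq> UNIV \<Longrightarrow> x i = y i\<close> \<open>x i \<in> U i\<close> by simp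
      qed simp
      then show ?thesis using U(3) by auto
    qed
    then show "\<exists>F. finite F \<and> (\<forall>y. agree F x y \<longrightarrow> y \<in> S)" using U(1) by blast
  qed
next
  assume R: ?R
  show ?L
    unfolding cantor_cube_def openin_product_topology_alt
  proof
    fix x assume "x \<in> S"
    with R obtain F where F: "finite F" "\<And>y. agree F x y \<Longrightarrow> y \<in> S" by blast
    let ?U = "\<lambda>i. if i \<in> F then {x i} else UNIV"
    have "{i. ?U i \<noteq> UNIV} \<subseteq> F" by auto
    then have "finite {i. ?U i \<noteq> UNIV}" using F(1) finite_subset by blast
    moreover have "y \<in> S" if "y \<in> Pi\<^sub>E UNIV ?U" for y
    proof (rule F(2))
      have "y i \<in> ?U i" for i using that unfolding PiE_iff by blast
      then have "i \<in> F \<Longrightarrow> y i \<in> {x i}" for i by (metis (full_types))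
      then show "agree F x y" unfolding agree_def by blast
    qed
    ultimately show "\<exists>U. finite {i \<in> UNIV. U i \<noteq> topspace (discrete_topology UNIV)} \<and>
        (\<forall>i\<in>UNIV. openin (discrete_topology UNIV) (U i)) \<and> x \<in> Pi\<^sub>E UNIV U \<and> Pi\<^sub>E UNIV U \<subseteq> S"
      by (intro exI[of _ ?U]) auto
  qed
qed

lemma compact_space_cantor_cube: "compact_space (cantor_cube I)"
  by (simp add: cantor_cube_def compact_space_product_topology compact_space_discrete_topology)

text \<open>Compactness of the cube, applied to the open cylinders given by
  \<open>F\<close>.\<close>

lemma finite_cylinder_subcover:
  assumes "\<And>x. finite (F x)"
  obtains D where "finite D" "\<And>y :: 'i \<Rightarrow> bool. \<exists>x\<in>D. agree (F x) x y"
proof -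
  let ?C = "\<lambda>x. {y. agree (F x) x y}"
  have "openin (cantor_cube UNIV) (?C x)" for x
    unfolding openin_cantor_cube_UNIV using assms agree_trans by blast
  moreover have "UNIV = \<Union>(range ?C)" using agree_refl by blast
  ultimately have "\<exists>\<C>. finite \<C> \<and> \<C> \<subseteq> range ?C \<and> UNIV \<subseteq> \<Union>\<C>"
    using compact_space_cantor_cube[of UNIV]
    by (intro compactinD[of "cantor_cube UNIV"]) (auto simp: compact_space_def)
  then obtain \<C> where \<C>: "finite \<C> \<and> \<C> \<subseteq> range ?C \<and> UNIV \<subseteq> \<Union>\<C>" ..
  then obtain D where D: "finite D" "\<C> = ?C ` D"
    using finite_subset_image[of \<C> ?C UNIV] by auto
  have "\<exists>x\<in>D. agree (F x) x y" for y
  proof -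
    have "y \<in> \<Union>\<C>" using \<C> by blast
    then show ?thesis using D(2) by simp
  qed
  then show thesis using that[of D] D(1) by simp
qed

text \<open>The union of the local supports over a finite subcover serves all points, because
  \<open>P\<close> is monotone in the support.\<close>

lemma uniform_finite_support:
  assumes local: "\<And>x. \<exists>F. finite F \<and> (\<forall>y. agree F x y \<longrightarrow> P F y)"
    and mono: "\<And>F G y. \<lbrakk>P F y; F \<subseteq> G\<rbrakk> \<Longrightarrow> P G y"
  shows "\<exists>F. finite F \<and> (\<forall>y :: 'i \<Rightarrow> bool. P F y)"
proof -
  have "\<exists>F. \<forall>x. finite (F x) \<and> (\<forall>y. agree (F x) x y \<longrightarrow> P (F x) y)"
    by (intro choice allI local)
  then obtain F where *: "\<forall>x. finite (F x) \<and> (\<forall>y. agree (F x) x y \<longrightarrow> P (F x) y)" ..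
  have F: "\<And>x. finite (F x)" "\<And>x y. agree (F x) x y \<Longrightarrow> P (F x) y"
    using * by simp_all
  obtain D where D: "finite D" "\<And>y. \<exists>x\<in>D. agree (F x) x y"
    by (rule finite_cylinder_subcover[of F]) (use F(1) in simp_all)
  have "P (\<Union>x\<in>D. F x) y" for y
  proof -
    obtain x where x: "x \<in> D" "agree (F x) x y" using D(2) by auto
    show ?thesis by (rule mono[OF F(2)[OF x(2)]]) (use x(1) in auto)
  qed
  then show ?thesis using D(1) F(1) by (intro exI[of _ "\<Union>x\<in>D. F x"]) auto
qed

section \<open>Images of Cantor cubes\<close>

text \<open>With the cube over the whole index type every function is a point, so points can be
  spliced coordinatewise without side conditions.\<close>

locale dyadic_map =
  fixes X :: "'a topology" and g :: "('i \<Rightarrow> bool) \<Rightarrow> 'a"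
  assumes compact: "compact_space X" and Hausdorff: "Hausdorff_space X"
    and continuous: "continuous_map (cantor_cube UNIV) X g"
    and range_g: "range g = topspace X"
begin

lemma g_in_topspace [simp]: "g x \<in> topspace X"
  using range_g by blast

lemma topspaceE:
  assumes "p \<in> topspace X" obtains x where "g x = p"
  using assms range_g by (metis imageE)

lemma finite_support:
  assumes "openin X U" "g x \<in> U"
  obtains F where "finite F" "\<And>y. agree F x y \<Longrightarrow> g y \<in> U"
proof -
  have "openin (cantor_cube UNIV) {x. g x \<in> U}"
    using openin_continuous_map_preimage[OF continuous assms(1)] by simp
  then show thesis
    using that assms(2) unfolding openin_cantor_cube_UNIV by blast
qed

lemma separating_support:
  assumes "g x \<noteq> g y"
  obtains F where "finite F" "\<And>x' y'. agree F x x' \<Longrightarrow> agree F y y' \<Longrightarrow> g x' \<noteq> g y'"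
proof -
  obtain U V where UV: "openin X U" "openin X V" "g x \<in> U" "g y \<in> V" "disjnt U V"
    using Hausdorff assms unfolding Hausdorff_space_def by (meson g_in_topspace)
  obtain F where F: "finite F" "\<And>x'. agree F x x' \<Longrightarrow> g x' \<in> U"
    using finite_support[OF UV(1,3)] by blast
  obtain G where G: "finite G" "\<And>y'. agree G y y' \<Longrightarrow> g y' \<in> V"
    using finite_support[OF UV(2,4)] by blast
  show thesis
  proof (rule that[of "F \<union> G"])
    fix x' y' assume "agree (F \<union> G) x x'" "agree (F \<union> G) y y'"
    then have "g x' \<in> U" "g y' \<in> V" using F(2) G(2) agree_mono by blast+
    then show "g x' \<noteq> g y'" using UV(5) by (auto simp: disjnt_iff)
  qed (use F G in auto)
qed

lemma shrink:
  assumes "closedin X C" "openin X V" "C \<subseteq> V"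
  obtains U where "openin X U" "C \<subseteq> U" "X closure_of U \<subseteq> V"
  using compact_Hausdorff_or_regular_imp_normal_space[OF compact] Hausdorff assms
  unfolding normal_space_alt by blast

lemma shrink_point:
  assumes "openin X V" "p \<in> V"
  obtains U where "openin X U" "p \<in> U" "X closure_of U \<subseteq> V"
proof -
  have "p \<in> topspace X" using assms openin_subset by blast
  then have "closedin X {p}" by (simp add: Hausdorff closedin_Hausdorff_sing_eq)
  then obtain U where "openin X U" "{p} \<subseteq> U" "X closure_of U \<subseteq> V"
    using shrink[of "{p}" V] assms by (metis empty_subsetI insert_subset)
  then show thesis using that[of U] by simp
qed

text \<open>Near a point mapped into \<open>V\<close> the conclusion holds by continuity; near any
  other point \<open>g\<close> avoids the closure of \<open>U\<close>, so the premise fails.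
  Compactness makes the support uniform.\<close>

lemma closure_support:
  assumes "openin X U" "openin X V" "X closure_of U \<subseteq> V"
  obtains F where "finite F" "\<And>x y. agree F x y \<Longrightarrow> g x \<in> U \<Longrightarrow> g y \<in> V"
proof -
  let ?P = "\<lambda>F x. \<forall>y. agree F x y \<longrightarrow> g x \<in> U \<longrightarrow> g y \<in> V"
  have "\<exists>F. finite F \<and> (\<forall>y. agree F x y \<longrightarrow> ?P F y)" for x
  proof (cases "g x \<in> V")
    case True
    obtain F where F: "finite F" "\<And>y. agree F x y \<Longrightarrow> g y \<in> V"
      using finite_support[OF assms(2) True] by blast
    show ?thesis using F agree_trans by (intro exI[of _ F]) blast
  next
    case False
    then have "g x \<in> topspace X - X closure_of U" using assms(3) by auto
    moreover have "openin X (topspace X - X closure_of U)"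
      using closedin_closure_of by blast
    ultimately obtain F where F: "finite F" "\<And>y. agree F x y \<Longrightarrow> g y \<in> topspace X - X closure_of U"
      using finite_support by blast
    have "U \<subseteq> X closure_of U"
      using assms(1) by (simp add: closure_of_subset openin_subset)
    then show ?thesis using F by (intro exI[of _ F]) blast
  qed
  moreover have "?P G x" if "?P F x" "F \<subseteq> G" for F G x
    using that agree_mono by blast
  ultimately have "\<exists>F. finite F \<and> (\<forall>x. ?P F x)"
    by (rule uniform_finite_support[of ?P])
  then show thesis using that by blast
qed


text \<open>The recursion has length \<open>|T|\<close>, and \<open>P\<close> consists of the admissible open sets. Stage \<open>t\<close>
  contributes finitely many sets that together must satisfy \<open>good t\<close>.\<close>

lemma op_like_family:
  fixes T :: "'t set" and P :: "'a set set" and good :: "'t \<Rightarrow> 'a set set \<Rightarrow> bool"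
  assumes T: "infinite T"
    and P_open: "\<And>U. U \<in> P \<Longrightarrow> openin X U"
    and P_shrink: "\<And>U. U \<in> P \<Longrightarrow> \<exists>U'\<in>P. X closure_of U' \<subseteq> U"
    and task: "\<And>t A. \<lbrakk>t \<in> T; A \<subseteq> P; |A| <o |T|\<rbrakk> \<Longrightarrow>
      \<exists>W. finite W \<and> good t (fst ` W) \<and>
        (\<forall>(U, V)\<in>W. U \<in> P \<and> openin X V \<and> X closure_of U \<subseteq> V \<and> (\<forall>a\<in>A. \<not> a \<subseteq> V))"
  shows "\<exists>B\<subseteq>P. op_like natLeq B \<and> (\<forall>t\<in>T. \<exists>\<U>\<subseteq>B. good t \<U>)"
proof -
  let ?R = "|T| - Id"
  define S where "S = underS |T|"
  have wo: "Well_order |T|" by (rule card_of_Well_order)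
  have wfR: "wf ?R" using wo by (simp add: well_order_on_def Field_card_of)
  have R_iff: "(s, t) \<in> ?R \<longleftrightarrow> s \<in> S t" for s t
    by (auto simp: S_def underS_def)
  have under_T: "S t \<subseteq> T" for t
    using Field_card_of[of T] by (auto simp: S_def underS_def Field_def)
  (* f t = (pairs chosen at stage t, their joint finite support); J f t = coordinates used before t *)
  define J where "J f t = (\<Union>s\<in>S t. snd (f s))"
    for f :: "'t \<Rightarrow> ('a set \<times> 'a set) set \<times> 'i set" and t :: 't
  \<comment> \<open>\<open>E (J f t)\<close> holds the possible interpolants supported by earlier
    coordinates. If \<open>V\<close> contains none of them, then \<open>U\<close> can lie above a
    set only by means of a new coordinate.\<close>
  define E where "E H = {e. (\<exists>G. G \<subseteq> H \<and> finite G \<and> saturated G e) \<and> (\<exists>U\<in>P. g -` U \<subseteq> e)}"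
    for H :: "'i set"
  \<comment> \<open>\<open>V\<close> is the slack around \<open>U\<close>: avoidance is demanded of
    the larger set \<open>V\<close>, and \<open>snd r\<close> supports a clopen set between the two
    preimages. The guard \<open>t \<in> T\<close> is there because the choice principle runs over
    the whole type.\<close>
  define Q where "Q f t r \<longleftrightarrow> (t \<in> T \<longrightarrow> finite (fst r) \<and> finite (snd r) \<and> good t (fst ` fst r) \<and>
      (\<forall>(U, V)\<in>fst r. U \<in> P \<and> (\<forall>x y. agree (snd r) x y \<longrightarrow> g x \<in> U \<longrightarrow> g y \<in> V) \<and>
         (\<forall>e\<in>E (J f t). \<not> e \<subseteq> g -` V)))" for f :: "'t \<Rightarrow> ('a set \<times> 'a set) set \<times> 'i set" and t :: 't and r :: "('a set \<times> 'a set) set \<times> 'i set"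
  have "\<exists>f. \<forall>t. Q f t (f t)"
  proof (rule dependent_wf_choice[OF wfR])
    fix f f' :: "'t \<Rightarrow> ('a set \<times> 'a set) set \<times> 'i set" and t :: 't and r :: "('a set \<times> 'a set) set \<times> 'i set"
    assume "\<And>s. (s, t) \<in> ?R \<Longrightarrow> f s = f' s"
    then have "J f t = J f' t" unfolding J_def R_iff by auto
    then show "Q f t r = Q f' t r" by (simp add: Q_def)
  next
    fix t :: 't and f :: "'t \<Rightarrow> ('a set \<times> 'a set) set \<times> 'i set" assume IH: "\<And>s. (s, t) \<in> ?R \<Longrightarrow> Q f s (f s)"
    show "\<exists>r. Q f t r"
    proof (cases "t \<in> T")
      case True
      have fin: "finite (snd (f s))" if "s \<in> S t" for s
        using IH[of s] that under_T[of t] unfolding R_iff by (auto simp: Q_def)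
      have "|S t| <o |T|"
        unfolding S_def using True by (intro card_of_underS card_of_Card_order) (simp add: Field_card_of)
      then have "|{e. \<exists>G. G \<subseteq> J f t \<and> finite G \<and> saturated G e}| <o |T|"
        unfolding J_def using fin by (intro card_of_saturated_ordLess[OF T]) auto
      moreover have "|E (J f t)| \<le>o |{e. \<exists>G. G \<subseteq> J f t \<and> finite G \<and> saturated G e}|"
        by (intro card_of_mono1) (auto simp: E_def)
      ultimately have E_less: "|E (J f t)| <o |T|" using ordLeq_ordLess_trans by blast
      \<comment> \<open>\<open>task\<close> avoids members of \<open>P\<close>, so each
        \<open>e\<close> is represented by some \<open>u e\<close> whose preimage lies inside
        it.\<close>
      have "\<forall>e\<in>E (J f t). \<exists>U. U \<in> P \<and> g -` U \<subseteq> e"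
        unfolding E_def by blast
      then have "\<exists>u. \<forall>e\<in>E (J f t). u e \<in> P \<and> g -` u e \<subseteq> e"
        by (rule bchoice)
      then obtain u where u: "\<forall>e\<in>E (J f t). u e \<in> P \<and> g -` u e \<subseteq> e" ..
      have "|u ` E (J f t)| <o |T|"
        using E_less card_of_image ordLeq_ordLess_trans by blast
      then have "\<exists>W. finite W \<and> good t (fst ` W) \<and>
        (\<forall>(U, V)\<in>W. U \<in> P \<and> openin X V \<and> X closure_of U \<subseteq> V \<and> (\<forall>a\<in>u ` E (J f t). \<not> a \<subseteq> V))"
        using u by (intro task True) auto
      then obtain W where W: "finite W" "good t (fst ` W)"
        "\<forall>(U, V)\<in>W. U \<in> P \<and> openin X V \<and> X closure_of U \<subseteq> V \<and> (\<forall>a\<in>u ` E (J f t). \<not> a \<subseteq> V)"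
        by (elim exE conjE) (rule that)
      have "\<forall>w\<in>W. \<exists>F. finite F \<and> (\<forall>x y. agree F x y \<longrightarrow> g x \<in> fst w \<longrightarrow> g y \<in> snd w)"
      proof
        fix w assume "w \<in> W"
        then have "openin X (fst w)" "openin X (snd w)" "X closure_of (fst w) \<subseteq> snd w"
          using bspec[OF W(3) \<open>w \<in> W\<close>] P_open by (cases w; auto)+
        then show "\<exists>F. finite F \<and> (\<forall>x y. agree F x y \<longrightarrow> g x \<in> fst w \<longrightarrow> g y \<in> snd w)"
          by (meson closure_support)
      qed
      then have "\<exists>F. \<forall>w\<in>W. finite (F w) \<and> (\<forall>x y. agree (F w) x y \<longrightarrow> g x \<in> fst w \<longrightarrow> g y \<in> snd w)"
        by (rule bchoice)
      then obtain F where *: "\<forall>w\<in>W. finite (F w) \<and> (\<forall>x y. agree (F w) x y \<longrightarrow> g x \<in> fst w \<longrightarrow> g y \<in> snd w)" ..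
      have F: "\<And>w. w \<in> W \<Longrightarrow> finite (F w)"
        "\<And>w x y. \<lbrakk>w \<in> W; agree (F w) x y; g x \<in> fst w\<rbrakk> \<Longrightarrow> g y \<in> snd w"
        using * by blast+
      have "\<not> e \<subseteq> g -` V" if "(U, V) \<in> W" "e \<in> E (J f t)" for U V e
      proof
        assume "e \<subseteq> g -` V"
        then have "g -` u e \<subseteq> g -` V" using u that(2) by blast
        moreover have "u e \<subseteq> range g" using u that(2) P_open openin_subset range_g by blast
        ultimately have "u e \<subseteq> V" by blast
        then show False using W(3) that by blast
      qed
      moreover have "g y \<in> V" if "(U, V) \<in> W" "agree (\<Union>w\<in>W. F w) x y" "g x \<in> U" for U V x y
        using F(2)[OF that(1)] that agree_mono[OF that(2), of "F (U, V)"] by auto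
      ultimately have "Q f t (W, \<Union>w\<in>W. F w)"
        unfolding Q_def using W F(1) by fastforce
      then show ?thesis by blast
    qed (auto simp: Q_def)
  qed
  then obtain f where "\<forall>t. Q f t (f t)" ..
  then have f: "\<And>t. Q f t (f t)" by simp
  define B where "B = (\<Union>t\<in>T. fst ` fst (f t))"
  have BP: "B \<subseteq> P" using f unfolding B_def Q_def by fastforce
  have "finite {q\<in>B. p \<subseteq> q}" if "p \<in> B" for p
  proof -
    have "p \<in> P" using that BP by blast
    then obtain p' where p': "p' \<in> P" "X closure_of p' \<subseteq> p"
      using P_shrink[OF \<open>p \<in> P\<close>] by (elim bexE) (rule that)
    obtain D where D: "finite D" "\<And>x y. agree D x y \<Longrightarrow> g x \<in> p' \<Longrightarrow> g y \<in> p"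
      by (rule closure_support[OF P_open[OF p'(1)] P_open[OF \<open>p \<in> P\<close>] p'(2)]) (rule that)
    \<comment> \<open>The stages that are the first to use some coordinate of \<open>D\<close>; only
      these can contribute sets above \<open>p\<close>.\<close>
    define M where "M = {t\<in>T. \<exists>i\<in>D. i \<in> snd (f t) \<and> i \<notin> J f t}"
    \<comment> \<open>Interpolation: otherwise \<open>?e\<close>, the hull of the preimage of
      \<open>p'\<close> over the common coordinates, belongs to \<open>E (J f t)\<close>. A point of
      \<open>?e\<close> and its partner over \<open>p'\<close> splice to \<open>?z\<close>, which is
      mapped into \<open>U\<close> because of \<open>D\<close> and thereby forces the point over
      \<open>V\<close>.\<close>
    have M_new: "t \<in> M" if t: "t \<in> T" "(U, V) \<in> fst (f t)" "p \<subseteq> U" for t U V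
    proof (rule ccontr)
      assume "t \<notin> M"
      then have sub: "D \<inter> snd (f t) \<subseteq> J f t" using t by (auto simp: M_def)
      let ?G = "D \<inter> snd (f t)"
      let ?e = "{x. \<exists>y. agree ?G x y \<and> g y \<in> p'}"
      have "saturated ?G ?e"
        unfolding saturated_def using agree_sym agree_trans by blast
      moreover have "g -` p' \<subseteq> ?e" using agree_refl by blast
      ultimately have "?e \<in> E (J f t)"
        unfolding E_def using sub D(1) p'(1) by blast
      moreover have "?e \<subseteq> g -` V"
      proof
        fix x assume "x \<in> ?e"
        then obtain y where y: "agree ?G x y" "g y \<in> p'" by blast
        let ?z = "\<lambda>i. if i \<in> snd (f t) then x i else y i"
        have "agree D y ?z" using y(1) by (auto simp: agree_def)
        then have "g ?z \<in> U" using D(2) y(2) t(3) by blast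
        moreover have "agree (snd (f t)) ?z x" by (auto simp: agree_def)
        ultimately show "x \<in> g -` V" using f[of t] t(1,2) by (fastforce simp: Q_def)
      qed
      ultimately show False using f[of t] t(1,2) unfolding Q_def by blast
    qed
    \<comment> \<open>A coordinate is new at one stage only, so \<open>M\<close> injects into
      \<open>D\<close>.\<close>
    have "finite M"
    proof -
      have "\<exists>i. i \<in> D \<and> i \<in> snd (f t) \<and> i \<notin> J f t" if "t \<in> M" for t
        using that by (auto simp: M_def)
      then have "\<exists>k. \<forall>t\<in>M. k t \<in> D \<and> k t \<in> snd (f t) \<and> k t \<notin> J f t"
        by (intro bchoice) blast
      then obtain k where "\<forall>t\<in>M. k t \<in> D \<and> k t \<in> snd (f t) \<and> k t \<notin> J f t" ..
      then have k: "\<And>t. t \<in> M \<Longrightarrow> k t \<in> D \<and> k t \<in> snd (f t) \<and> k t \<notin> J f t"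
        by blast
      have "inj_on k M"
      proof (rule inj_onI, rule ccontr)
        fix s t assume st: "s \<in> M" "t \<in> M" "k s = k t" "s \<noteq> t"
        have "s \<in> T" "t \<in> T" using st by (auto simp: M_def)
        then have "(s, t) \<in> |T| \<or> (t, s) \<in> |T|"
          using card_of_well_order_on[of T] st(4)
          unfolding well_order_on_def linear_order_on_def total_on_def by blast
        then have "s \<in> S t \<or> t \<in> S s"
          using st(4) by (auto simp: S_def underS_def)
        then show False using k[OF st(1)] k[OF st(2)] st(3) unfolding J_def by auto
      qed
      moreover have "k ` M \<subseteq> D" using k by blast
      ultimately show ?thesis using D(1) by (meson finite_imageD finite_subset)
    qed
    moreover have "{q\<in>B. p \<subseteq> q} \<subseteq> (\<Union>t\<in>M. fst ` fst (f t))"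
    proof
      fix q assume "q \<in> {q\<in>B. p \<subseteq> q}"
      then obtain t w where "t \<in> T" "w \<in> fst (f t)" "q = fst w" "p \<subseteq> q"
        unfolding B_def by blast
      moreover from this have "t \<in> M" using M_new[of t "fst w" "snd w"] by simp
      ultimately show "q \<in> (\<Union>t\<in>M. fst ` fst (f t))" by blast
    qed
    moreover have "finite (fst ` fst (f t))" if "t \<in> M" for t
      using f[of t] that by (auto simp: Q_def M_def)
    ultimately show ?thesis by (rule_tac finite_subset[OF _ finite_UN_I])
  qed
  then have "op_like natLeq B" by (simp add: op_like_natLeq)
  moreover have "\<exists>\<U>\<subseteq>B. good t \<U>" if "t \<in> T" for t
    using f[of t] that unfolding Q_def B_def by (intro exI[of _ "fst ` fst (f t)"]) auto
  ultimately show ?thesis using BP by (intro exI[of _ B]) simp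
qed

end

section \<open>Neighbourhood bases and \<open>\<pi>\<close>-bases\<close>

text \<open>Zorn's lemma; it will be applied to disjoint open sets and to disjoint finite
  supports.\<close>

lemma ex_maximal_pairwise:
  obtains M where "M \<subseteq> S" "pairwise R M" "\<And>x. x \<in> S - M \<Longrightarrow> \<exists>y\<in>M. \<not> R x y \<or> \<not> R y x"
proof -
  let ?A = "{M. M \<subseteq> S \<and> pairwise R M}"
  have "\<exists>M\<in>?A. \<forall>N\<in>?A. M \<subseteq> N \<longrightarrow> N = M"
  proof (rule subset_Zorn')
    fix C assume C: "subset.chain ?A C"
    have "R x y" if xy: "x \<in> \<Union>C" "y \<in> \<Union>C" "x \<noteq> y" for x y
    proof -
      obtain M N where MN: "M \<in> C" "N \<in> C" "x \<in> M" "y \<in> N" using xy by auto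
      then have "M \<subseteq> N \<or> N \<subseteq> M" using C unfolding subset_chain_def by blast
      then obtain L where "L \<in> C" "x \<in> L" "y \<in> L" using MN by auto
      moreover then have "pairwise R L" using C unfolding subset_chain_def by blast
      ultimately show ?thesis using xy(3) by (simp add: pairwise_def)
    qed
    then show "\<Union>C \<in> ?A"
      using C by (auto simp: pairwise_def subset_chain_def)
  qed
  then obtain M where M: "M \<in> ?A" and max: "\<forall>N\<in>?A. M \<subseteq> N \<longrightarrow> N = M" by (rule bexE)
  have "\<exists>y\<in>M. \<not> R x y \<or> \<not> R y x" if x: "x \<in> S - M" for x
  proof (rule ccontr)
    assume "\<not> ?thesis"
    then have "insert x M \<in> ?A" using M x by (auto simp: pairwise_insert)
    then have "insert x M = M" using max by blast
    then show False using x by blast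
  qed
  then show thesis using that[of M] M by simp
qed

context dyadic_map begin

text \<open>The recursion runs along a neighbourhood base of least cardinality: fewer neighbourhoods
  do not form a base, so some neighbourhood contains none of them.\<close>

lemma chiNt_eq_omega_closed:
  assumes K: "closedin X K"
  shows "chiNt_eq_omega X K"
proof -
  have "is_nbhd_base X K {U. openin X U \<and> K \<subseteq> U}" by (auto simp: is_nbhd_base_def)
  from ex_minimal_card[of "is_nbhd_base X K", OF this]
  obtain T where T: "is_nbhd_base X K T" and "\<forall>C. is_nbhd_base X K C \<longrightarrow> |T| \<le>o |C|"
    by (elim exE conjE) (rule that)
  then have min: "\<And>C. is_nbhd_base X K C \<Longrightarrow> |T| \<le>o |C|" by simp
  have T_open: "openin X t \<and> K \<subseteq> t" if "t \<in> T" for t using T that by (simp add: is_nbhd_base_def)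
  have T_nbhd: "\<exists>t\<in>T. t \<subseteq> U" if "openin X U" "K \<subseteq> U" for U using T that by (simp add: is_nbhd_base_def)
  show ?thesis
  proof (cases "finite T")
    \<comment> \<open>The intersection of a finite base is the least neighbourhood of
      \<open>K\<close>.\<close>
    case True
    have "T \<noteq> {}" using T_nbhd[of "topspace X"] closedin_subset[OF K] by auto
    then have "openin X (\<Inter>T)" using T_open True by (intro openin_Inter) auto
    moreover have "K \<subseteq> \<Inter>T" using T_open by blast
    moreover have "\<Inter>T \<subseteq> U" if "openin X U" "K \<subseteq> U" for U using T_nbhd[OF that] by blast
    ultimately have "is_nbhd_base X K {\<Inter>T}" by (simp add: is_nbhd_base_def)
    moreover have "op_like natLeq {\<Inter>T}" by (simp add: op_like_natLeq)
    ultimately show ?thesis unfolding chiNt_eq_omega_def by blast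
  next
    case False
    let ?P = "{U. openin X U \<and> K \<subseteq> U}"
    \<comment> \<open>Stage \<open>t\<close> contributes a neighbourhood of \<open>K\<close> inside
      \<open>t\<close>, so the result is again a base.\<close>
    have "\<exists>B\<subseteq>?P. op_like natLeq B \<and> (\<forall>t\<in>T. \<exists>\<U>\<subseteq>B. \<exists>U\<in>\<U>. U \<subseteq> t)"
    proof (rule op_like_family[OF False])
      fix U assume "U \<in> ?P"
      then have "openin X U" "K \<subseteq> U" by auto
      then obtain U' where "openin X U'" "K \<subseteq> U'" "X closure_of U' \<subseteq> U" by (rule shrink[OF K])
      then show "\<exists>U'\<in>?P. X closure_of U' \<subseteq> U" by (intro bexI[of _ U']) auto
    next
      fix t A assume t: "t \<in> T" and A: "A \<subseteq> ?P" "|A| <o |T|"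
      have "\<not> is_nbhd_base X K A" using min not_ordLess_ordLeq[OF A(2)] by (rule contrapos_nn[rotated])
      moreover have "\<forall>U\<in>A. openin X U \<and> K \<subseteq> U" using A(1) by blast
      ultimately have "\<exists>V0. openin X V0 \<and> K \<subseteq> V0 \<and> (\<forall>a\<in>A. \<not> a \<subseteq> V0)"
        unfolding is_nbhd_base_def by simp
      then obtain V0 where V0: "openin X V0" "K \<subseteq> V0" "\<forall>a\<in>A. \<not> a \<subseteq> V0"
        by (elim exE conjE) (rule that)
      have "openin X (V0 \<inter> t)" "K \<subseteq> V0 \<inter> t" using V0 T_open[OF t] by auto
      then obtain U where "openin X U" "K \<subseteq> U" "X closure_of U \<subseteq> V0 \<inter> t" by (rule shrink[OF K])
      moreover from this have "U \<subseteq> t" using closure_of_subset[of U X] openin_subset by blast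
      ultimately show "\<exists>W. finite W \<and> (\<exists>U\<in>fst ` W. U \<subseteq> t) \<and>
          (\<forall>(U, V)\<in>W. U \<in> ?P \<and> openin X V \<and> X closure_of U \<subseteq> V \<and> (\<forall>a\<in>A. \<not> a \<subseteq> V))"
        using V0(3) \<open>openin X (V0 \<inter> t)\<close> by (intro exI[of _ "{(U, V0 \<inter> t)}"]) auto
    qed simp
    then obtain B where B: "B \<subseteq> ?P" "op_like natLeq B" "\<forall>t\<in>T. \<exists>\<U>\<subseteq>B. \<exists>U\<in>\<U>. U \<subseteq> t"
      by (elim exE conjE) (rule that)
    have "\<exists>V\<in>B. V \<subseteq> U" if U: "openin X U" "K \<subseteq> U" for U
    proof -
      obtain t where "t \<in> T" "t \<subseteq> U" using T_nbhd[OF U] by auto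
      then show ?thesis using B(3) by (meson subset_iff order_trans)
    qed
    then have "is_nbhd_base X K B" using B(1) by (auto simp: is_nbhd_base_def)
    then show ?thesis using B(2) unfolding chiNt_eq_omega_def by blast
  qed
qed

section \<open>\<pi>-bases of open subsets\<close>

definition pi_base_in :: "'a set \<Rightarrow> 'a set set \<Rightarrow> bool" where
  "pi_base_in W B \<longleftrightarrow> (\<forall>U\<in>B. openin X U \<and> U \<noteq> {} \<and> U \<subseteq> W) \<and>
     (\<forall>U. openin X U \<and> U \<noteq> {} \<and> U \<subseteq> W \<longrightarrow> (\<exists>V\<in>B. V \<subseteq> U))"

text \<open>\<open>W\<close> and \<open>T\<close> are chosen together so that \<open>|T|\<close> is
  least among all \<pi>-bases of nonempty open subsets of \<open>V\<close>. Hence no nonempty open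
  subset of \<open>W\<close> has a smaller \<pi>-base, which is what the recursion needs.\<close>

lemma ex_op_like_pi_base_in:
  assumes "openin X V" "V \<noteq> {}"
  shows "\<exists>W B. openin X W \<and> W \<noteq> {} \<and> W \<subseteq> V \<and> pi_base_in W B \<and> op_like natLeq B"
proof -
  let ?Q = "\<lambda>T. \<exists>W. openin X W \<and> W \<noteq> {} \<and> W \<subseteq> V \<and> pi_base_in W T"
  have "?Q {U. openin X U \<and> U \<noteq> {} \<and> U \<subseteq> V}"
    using assms by (intro exI[of _ V]) (auto simp: pi_base_in_def)
  from ex_minimal_card[of ?Q, OF this] obtain T where T: "?Q T \<and> (\<forall>C. ?Q C \<longrightarrow> |T| \<le>o |C| )" ..
  have min: "|T| \<le>o |C|" if "?Q C" for C
    using T that by (elim conjE allE[of _ C]) (rule mp)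
  from conjunct1[OF T] obtain W where W: "openin X W" "W \<noteq> {}" "W \<subseteq> V" "pi_base_in W T"
    by (elim exE conjE) (rule that)
  have T_open: "openin X t \<and> t \<noteq> {} \<and> t \<subseteq> W" if "t \<in> T" for t
    using W(4) that by (simp add: pi_base_in_def)
  have T_pi: "\<exists>t\<in>T. t \<subseteq> U" if "openin X U" "U \<noteq> {}" "U \<subseteq> W" for U
    using W(4) that by (simp add: pi_base_in_def)
  show ?thesis
  proof (cases "finite T")
    \<comment> \<open>A minimal member of a finite \<pi>-base has no proper nonempty open subset, so
      it is a one-element \<pi>-base of itself.\<close>
    case True
    have "T \<noteq> {}" using T_pi[OF W(1,2) subset_refl] by auto
    then obtain t where t: "t \<in> T" "\<And>s. s \<in> T \<Longrightarrow> s \<subseteq> t \<Longrightarrow> s = t"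
      using finite_has_minimal[OF True] by metis
    have t_sub: "t \<subseteq> U" if U: "openin X U" "U \<noteq> {}" "U \<subseteq> t" for U
    proof -
      have "U \<subseteq> W" using U(3) T_open[OF t(1)] by blast
      then obtain s where s: "s \<in> T" "s \<subseteq> U" using T_pi[OF U(1,2)] by auto
      then have "s = t" using t(2) U(3) by simp
      then show ?thesis using s(2) by simp
    qed
    have "pi_base_in t {t}" unfolding pi_base_in_def using T_open[OF t(1)] t_sub by blast
    moreover have "op_like natLeq {t}" by (simp add: op_like_natLeq)
    moreover have "t \<subseteq> V" using T_open[OF t(1)] W(3) by blast
    ultimately show ?thesis using T_open[OF t(1)] by (intro exI[of _ t] exI[of _ "{t}"]) simp
  next
    case False
    let ?P = "{U. openin X U \<and> U \<noteq> {} \<and> U \<subseteq> W}"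
    have "\<exists>B\<subseteq>?P. op_like natLeq B \<and> (\<forall>t\<in>T. \<exists>\<U>\<subseteq>B. \<exists>U\<in>\<U>. U \<subseteq> t)"
    proof (rule op_like_family[OF False])
      fix U assume U: "U \<in> ?P"
      then obtain p where "openin X U" "p \<in> U" by auto
      then obtain U' where U': "openin X U'" "p \<in> U'" "X closure_of U' \<subseteq> U" by (rule shrink_point)
      moreover from U'(1,3) have "U' \<subseteq> U" using closure_of_subset[of U' X] openin_subset by blast
      ultimately show "\<exists>U'\<in>?P. X closure_of U' \<subseteq> U" using U by (intro bexI[of _ U']) auto
    next
      fix t A assume t: "t \<in> T" and A: "A \<subseteq> ?P" "|A| <o |T|"
      \<comment> \<open>Only members of \<open>A\<close> inside \<open>t\<close> can lie in an open
        subset of \<open>t\<close>, and there are too few of them to form a \<pi>-base of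
        \<open>t\<close>.\<close>
      have "\<not> pi_base_in t {a\<in>A. a \<subseteq> t}"
      proof
        assume *: "pi_base_in t {a\<in>A. a \<subseteq> t}"
        have "t \<subseteq> V" using T_open[OF t] W(3) by blast
        then have "|T| \<le>o |{a\<in>A. a \<subseteq> t}|" using T_open[OF t] * by (intro min exI[of _ t]) simp
        moreover have "|{a\<in>A. a \<subseteq> t}| \<le>o |A|" by (rule card_of_mono1) auto
        ultimately have "|T| \<le>o |A|" by (rule ordLeq_transitive)
        then show False using A(2) not_ordLess_ordLeq[of "|A|"] by blast
      qed
      moreover have "\<forall>U\<in>{a\<in>A. a \<subseteq> t}. openin X U \<and> U \<noteq> {} \<and> U \<subseteq> t" using A(1) by blast
      ultimately have "\<not> (\<forall>U. openin X U \<and> U \<noteq> {} \<and> U \<subseteq> t \<longrightarrow> (\<exists>V\<in>{a\<in>A. a \<subseteq> t}. V \<subseteq> U))"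
        unfolding pi_base_in_def by argo
      then have "\<exists>V0. openin X V0 \<and> V0 \<noteq> {} \<and> V0 \<subseteq> t \<and> (\<forall>a\<in>A. a \<subseteq> t \<longrightarrow> \<not> a \<subseteq> V0)"
        by (simp only: not_all not_imp conj_assoc) blast
      then obtain V0 where V0: "openin X V0" "V0 \<noteq> {}" "V0 \<subseteq> t" "\<forall>a\<in>A. a \<subseteq> t \<longrightarrow> \<not> a \<subseteq> V0"
        by (elim exE conjE) (rule that)
      then have V0_not: "\<forall>a\<in>A. \<not> a \<subseteq> V0" by (meson order_trans)
      obtain p where "p \<in> V0" using V0(2) by auto
      with V0(1) obtain U where U: "openin X U" "p \<in> U" "X closure_of U \<subseteq> V0" by (rule shrink_point)
      moreover from U(1,3) have "U \<subseteq> V0" using closure_of_subset[of U X] openin_subset by blast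
      moreover have "t \<subseteq> W" using T_open[OF t] by simp
      ultimately show "\<exists>W'. finite W' \<and> (\<exists>U\<in>fst ` W'. U \<subseteq> t) \<and>
          (\<forall>(U, V)\<in>W'. U \<in> ?P \<and> openin X V \<and> X closure_of U \<subseteq> V \<and> (\<forall>a\<in>A. \<not> a \<subseteq> V))"
        using V0 V0_not by (intro exI[of _ "{(U, V0)}"]) auto
    qed simp
    then obtain B where B: "B \<subseteq> ?P" "op_like natLeq B" "\<forall>t\<in>T. \<exists>\<U>\<subseteq>B. \<exists>U\<in>\<U>. U \<subseteq> t"
      by (elim exE conjE) (rule that)
    have "\<exists>V\<in>B. V \<subseteq> U" if U: "openin X U" "U \<noteq> {}" "U \<subseteq> W" for U
    proof -
      obtain t where "t \<in> T" "t \<subseteq> U" using T_pi[OF U] by auto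
      then show ?thesis using B(3) by (meson subset_iff order_trans)
    qed
    then have "pi_base_in W B" using B(1) by (auto simp: pi_base_in_def)
    then show ?thesis using B(2) W(1-3) by (intro exI[of _ W] exI[of _ B]) simp
  qed
qed

text \<open>The \<pi>-bases of the members of a maximal disjoint family are united. Maximality makes
  the family dense; disjointness confines all sets above \<open>p\<close> to the \<pi>-base that
  contains \<open>p\<close>.\<close>

lemma piNt_eq_omega: "piNt_eq_omega X"
proof -
  let ?S = "{W. openin X W \<and> W \<noteq> {} \<and> (\<exists>B. pi_base_in W B \<and> op_like natLeq B)}"
  obtain M where M: "M \<subseteq> ?S" "pairwise disjnt M"
    and max: "\<And>W. W \<in> ?S - M \<Longrightarrow> \<exists>W'\<in>M. \<not> disjnt W W' \<or> \<not> disjnt W' W"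
    by (rule ex_maximal_pairwise[where S="?S" and R=disjnt]) (rule that)
  have "\<exists>b. \<forall>W\<in>M. pi_base_in W (b W) \<and> op_like natLeq (b W)"
    using M(1) by (intro bchoice) blast
  then obtain b where b: "\<forall>W\<in>M. pi_base_in W (b W) \<and> op_like natLeq (b W)" ..
  have b_open: "openin X U \<and> U \<noteq> {} \<and> U \<subseteq> W" if "W \<in> M" "U \<in> b W" for W U
    using b that by (simp add: pi_base_in_def)
  let ?B = "\<Union>W\<in>M. b W"
  have "\<exists>V\<in>?B. V \<subseteq> U" if U: "openin X U" "U \<noteq> {}" for U
  proof -
    obtain W B where W: "openin X W" "W \<noteq> {}" "W \<subseteq> U" "pi_base_in W B" "op_like natLeq B"
      using ex_op_like_pi_base_in[OF U] by (elim exE conjE) (rule that)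
    have "\<exists>W'\<in>M. \<not> disjnt W W'"
    proof (cases "W \<in> M")
      case True
      then show ?thesis using W(2) by (intro bexI[of _ W]) auto
    next
      case False
      then show ?thesis using max[of W] W disjnt_sym by blast
    qed
    then obtain W' where W': "W' \<in> M" "W \<inter> W' \<noteq> {}" unfolding disjnt_def by blast
    moreover have "openin X W'" using M(1) W'(1) by auto
    ultimately obtain V where "V \<in> b W'" "V \<subseteq> W \<inter> W'"
      using b W(1) unfolding pi_base_in_def by (metis inf.cobounded2 openin_Int)
    then show ?thesis using W' W(3) by blast
  qed
  then have "is_pi_base X ?B"
    using b_open by (auto simp: is_pi_base_def)
  moreover have "finite {q\<in>?B. p \<subseteq> q}" if p: "p \<in> ?B" for p
  proof -
    from p obtain W where W: "W \<in> M" "p \<in> b W" by auto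
    have "q \<in> b W" if q: "q \<in> ?B" "p \<subseteq> q" for q
    proof -
      obtain W' where W': "W' \<in> M" "q \<in> b W'" using q(1) by auto
      have "\<not> disjnt W W'" using b_open[OF W] b_open[OF W'] q(2) unfolding disjnt_def by blast
      then have "W = W'" using M(2) W(1) W'(1) unfolding pairwise_def by blast
      then show ?thesis using W'(2) by simp
    qed
    then have "{q\<in>?B. p \<subseteq> q} \<subseteq> {q\<in>b W. p \<subseteq> q}" by blast
    moreover have "finite {q\<in>b W. p \<subseteq> q}" using b W by (simp add: op_like_natLeq)
    ultimately show ?thesis using finite_subset by blast
  qed
  ultimately show ?thesis
    unfolding piNt_eq_omega_def op_like_natLeq by blast
qed

end

section \<open>Weight and \<open>\<pi>\<close>-character\<close>

text \<open>Counts the clopen sets that will index a base of size at most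
  \<open>|L|\<close>.\<close>

lemma card_of_finitely_saturated_ordLeq:
  fixes J :: "'i set"
  assumes L: "infinite L" and J: "|J| \<le>o |L|"
  shows "|{e. \<exists>G. G \<subseteq> J \<and> finite G \<and> saturated G e}| \<le>o |L|"
proof -
  have "{e. \<exists>G. G \<subseteq> J \<and> finite G \<and> saturated G e} = (\<Union>G\<in>Fpow J. {e. saturated G e})"
    by (auto simp: Fpow_def)
  moreover have "|Fpow J| \<le>o |L|"
  proof (cases "finite J")
    case True
    then have "finite (Fpow J)" by (simp add: Fpow_def)
    then show ?thesis using card_of_finite_ordLeq_infinite L by blast
  next
    case False
    then show ?thesis using card_of_Fpow_ordLeq J ordLeq_transitive by blast
  qed
  moreover have "|{e. saturated G e}| \<le>o |L|" if "G \<in> Fpow J" for G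
    using that L finite_saturated[of G] by (intro card_of_finite_ordLeq_infinite) (auto simp: Fpow_def)
  ultimately show ?thesis using L by (simp add: card_of_UNION_ordLeq_infinite)
qed

text \<open>\<open>|L|\<^sup>+\<close> is a caliber of Cantor cubes; the argument is that of the \<open>\<Delta>\<close>-system lemma.\<close>

lemma ex_point_in_many_cylinders_aux:
  fixes F :: "'s \<Rightarrow> 'i set"
  assumes L: "infinite L" and "\<And>a. a \<in> S \<Longrightarrow> finite (F a) \<and> card (F a) = n" "\<not> |S| \<le>o |L|"
  shows "\<exists>y S'. S' \<subseteq> S \<and> \<not> |S'| \<le>o |L| \<and> (\<forall>a\<in>S'. agree (F a) (x a) y)"
  using assms(2,3)
proof (induction n arbitrary: S F)
  case 0
  have "agree (F a) (x a) y" if "a \<in> S" for a y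
  proof -
    have "F a = {}" using 0(1)[OF that] card_0_eq by blast
    then show ?thesis by (simp add: agree_def)
  qed
  then show ?case using 0(2) by blast
next
  case (Suc n)
  show ?case
  proof (cases "\<exists>i b. \<not> |{a\<in>S. i \<in> F a \<and> x a i = b}| \<le>o |L|")
    \<comment> \<open>More than \<open>|L|\<close> supports share the coordinate \<open>i\<close>
      with the same prescribed value; it is deleted for the induction and put back into
      \<open>y\<close> afterwards.\<close>
    case True
    then obtain i b where ib: "\<not> |{a\<in>S. i \<in> F a \<and> x a i = b}| \<le>o |L|" by (elim exE) (rule that)
    let ?S = "{a\<in>S. i \<in> F a \<and> x a i = b}"
    have fin: "finite (F a - {i}) \<and> card (F a - {i}) = n" if "a \<in> ?S" for a
      using that Suc.prems(1)[of a] by (simp add: card_Diff_singleton)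
    have "\<exists>y S'. S' \<subseteq> ?S \<and> \<not> |S'| \<le>o |L| \<and> (\<forall>a\<in>S'. agree (F a - {i}) (x a) y)"
      by (rule Suc.IH[OF _ ib]) (rule fin)
    then obtain y S' where y: "S' \<subseteq> ?S" "\<not> |S'| \<le>o |L|" "\<forall>a\<in>S'. agree (F a - {i}) (x a) y"
      by (elim exE conjE) (rule that)
    have "agree (F a) (x a) (y(i := b))" if "a \<in> S'" for a
      using y(1,3) that by (auto simp: agree_def)
    then show ?thesis using y(1,2) by blast
  next
    \<comment> \<open>Every coordinate lies in at most \<open>|L|\<close> supports. A maximal
      disjoint subfamily is then large, since its coordinates meet every support.\<close>
    case False
    have hit: "|{a\<in>S. i \<in> F a}| \<le>o |L|" for i
    proof -
      have "{a\<in>S. i \<in> F a} = (\<Union>b\<in>UNIV. {a\<in>S. i \<in> F a \<and> x a i = b})" by auto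
      moreover have "|\<Union>b\<in>UNIV. {a\<in>S. i \<in> F a \<and> x a i = b}| \<le>o |L|"
        using False L by (intro card_of_UNION_ordLeq_infinite card_of_finite_ordLeq_infinite) auto
      ultimately show ?thesis by simp
    qed
    obtain M where M: "M \<subseteq> S" "pairwise (\<lambda>a b. disjnt (F a) (F b)) M"
      and max: "\<And>a. a \<in> S - M \<Longrightarrow> \<exists>b\<in>M. \<not> disjnt (F a) (F b) \<or> \<not> disjnt (F b) (F a)"
      by (rule ex_maximal_pairwise[where S=S and R="\<lambda>a b. disjnt (F a) (F b)"]) (rule that)
    have "\<not> |M| \<le>o |L|"
    proof
      assume le: "|M| \<le>o |L|"
      let ?I = "\<Union>a\<in>M. F a"
      have I: "|?I| \<le>o |L|"
        using Suc.prems(1) M(1)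
        by (intro card_of_UNION_ordLeq_infinite[OF L le] ballI card_of_finite_ordLeq_infinite[OF _ L]) auto
      have "|\<Union>i\<in>?I. {a\<in>S. i \<in> F a}| \<le>o |L|"
        by (rule card_of_UNION_ordLeq_infinite[OF L I]) (use hit in simp)
      moreover have "S \<subseteq> (\<Union>i\<in>?I. {a\<in>S. i \<in> F a})"
      proof
        fix a assume a: "a \<in> S"
        have "\<exists>b\<in>M. \<exists>i. i \<in> F a \<and> i \<in> F b"
        proof (cases "a \<in> M")
          case True
          have "F a \<noteq> {}" using Suc.prems(1)[OF a] by auto
          then show ?thesis using True by blast
        next
          case False
          then show ?thesis using max[of a] a unfolding disjnt_iff by blast
        qed
        then show "a \<in> (\<Union>i\<in>?I. {a\<in>S. i \<in> F a})" using a by blast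
      qed
      ultimately have "|S| \<le>o |L|" using card_of_mono1 ordLeq_transitive by blast
      then show False using Suc.prems(2) by simp
    qed
    \<comment> \<open>Disjoint supports impose compatible conditions; \<open>SOME\<close> picks the
      unique member whose support contains \<open>i\<close>.\<close>
    moreover have "agree (F a) (x a) (\<lambda>i. x (SOME b. b \<in> M \<and> i \<in> F b) i)" if a: "a \<in> M" for a
      unfolding agree_def
    proof
      fix i assume i: "i \<in> F a"
      have "(SOME b. b \<in> M \<and> i \<in> F b) = a"
      proof (rule some_equality)
        fix b assume "b \<in> M \<and> i \<in> F b"
        then show "b = a" using M(2) a i unfolding pairwise_def disjnt_iff by blast
      qed (use a i in simp)
      then show "x a i = x (SOME b. b \<in> M \<and> i \<in> F b) i" by simp
    qed
    ultimately show ?thesis using M(1) by blast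
  qed
qed

text \<open>Supports have only countably many sizes, so more than \<open>|L|\<close> of them have
  the same size.\<close>

lemma ex_point_in_many_cylinders:
  fixes F :: "'s \<Rightarrow> 'i set"
  assumes L: "infinite L" and F: "\<And>a. a \<in> S \<Longrightarrow> finite (F a)" and S: "\<not> |S| \<le>o |L|"
  shows "\<exists>y S'. S' \<subseteq> S \<and> \<not> |S'| \<le>o |L| \<and> (\<forall>a\<in>S'. agree (F a) (x a) y)"
proof -
  let ?S = "\<lambda>n. {a\<in>S. card (F a) = n}"
  have "\<exists>n. \<not> |?S n| \<le>o |L|"
  proof (rule ccontr)
    assume "\<not> ?thesis"
    then have "|\<Union>n\<in>(UNIV::nat set). ?S n| \<le>o |L|"
      using L infinite_iff_card_of_nat by (intro card_of_UNION_ordLeq_infinite) auto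
    moreover have "(\<Union>n\<in>(UNIV::nat set). ?S n) = S" by auto
    ultimately show False using S by simp
  qed
  then obtain n where n: "\<not> |?S n| \<le>o |L|" ..
  have "\<exists>y S'. S' \<subseteq> ?S n \<and> \<not> |S'| \<le>o |L| \<and> (\<forall>a\<in>S'. agree (F a) (x a) y)"
    by (rule ex_point_in_many_cylinders_aux[OF L _ n]) (use F in simp)
  then show ?thesis by blast
qed

definition override :: "'i set \<Rightarrow> ('i \<Rightarrow> bool) \<Rightarrow> ('i \<Rightarrow> bool) \<Rightarrow> 'i \<Rightarrow> bool" where
  "override J x y = (\<lambda>i. if i \<in> J then x i else y i)"

lemma agree_override [simp]: "agree J x (override J x y)"
  by (simp add: agree_def override_def)

text \<open>Splicing: a condition on \<open>F\<close> and a condition on \<open>J\<close> are met by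
  one point if they are compatible on the common coordinates.\<close>

lemma agree_override_right: "agree (F \<inter> J) x y \<Longrightarrow> agree F y (override J x y)"
  by (auto simp: agree_def override_def)

context dyadic_map begin

definition local_pi_base :: "'a \<Rightarrow> 'a set set \<Rightarrow> bool" where
  "local_pi_base p A \<longleftrightarrow> (\<forall>U\<in>A. openin X U \<and> U \<noteq> {}) \<and>
     (\<forall>V. openin X V \<and> p \<in> V \<longrightarrow> (\<exists>U\<in>A. U \<subseteq> V))"

text \<open>Let \<open>x U\<close> be points and \<open>F U\<close> finite sets such that \<open>g\<close> maps every point agreeing with \<open>x U\<close> on \<open>F U\<close> into \<open>U\<close>.
  The union \<open>J\<close> of the sets \<open>F U\<close> works: points that agree with \<open>x U\<close> on \<open>J\<close> may be chosen arbitrarily off \<open>J\<close>,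
  and their limits as \<open>U\<close> shrinks to \<open>p\<close> are mapped to \<open>p\<close>.\<close>

lemma ex_constant_cube:
  assumes p: "p \<in> topspace X" and A: "local_pi_base p A" "|A| \<le>o |L|" and L: "infinite L"
  shows "\<exists>J x. |J| \<le>o |L| \<and> (\<forall>y. agree J x y \<longrightarrow> g y = p)"
proof -
  have "\<exists>w. finite (snd w) \<and> (\<forall>y. agree (snd w) (fst w) y \<longrightarrow> g y \<in> U)" if "U \<in> A" for U
  proof -
    have U: "openin X U" "U \<noteq> {}" using A(1) that by (auto simp: local_pi_base_def)
    then obtain q where "q \<in> U" by auto
    then have "q \<in> topspace X" using U(1) openin_subset by blast
    then obtain x where "g x = q" by (rule topspaceE)
    then have "g x \<in> U" using \<open>q \<in> U\<close> by simp
    obtain F where "finite F" "\<And>y. agree F x y \<Longrightarrow> g y \<in> U"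
      by (rule finite_support[OF U(1) \<open>g x \<in> U\<close>]) (rule that)
    then show ?thesis by (intro exI[of _ "(x, F)"]) simp
  qed
  then have "\<exists>w. \<forall>U\<in>A. finite (snd (w U)) \<and> (\<forall>y. agree (snd (w U)) (fst (w U)) y \<longrightarrow> g y \<in> U)"
    by (intro bchoice) simp
  then obtain w where
    w: "\<forall>U\<in>A. finite (snd (w U)) \<and> (\<forall>y. agree (snd (w U)) (fst (w U)) y \<longrightarrow> g y \<in> U)" ..
  let ?J = "\<Union>U\<in>A. snd (w U)"
  have "|?J| \<le>o |L|"
    using w by (intro card_of_UNION_ordLeq_infinite[OF L A(2)] ballI card_of_finite_ordLeq_infinite[OF _ L]) simp
  moreover have "\<exists>x. \<forall>y. agree ?J x y \<longrightarrow> g y = p"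
  proof (rule ccontr)
    \<comment> \<open>Then no \<open>x\<close> is a cluster point of the points
      \<open>fst (w U)\<close> as \<open>U\<close> shrinks to \<open>p\<close>: each
      \<open>x\<close> has a cylinder missing those with \<open>U\<close> inside some neighbourhood
      of \<open>p\<close>. Compactness of the cube refutes this.\<close>
    assume no: "\<not> ?thesis"
    have "\<exists>v. finite (fst v) \<and> openin X (snd v) \<and> p \<in> snd v \<and>
        (\<forall>U\<in>A. U \<subseteq> snd v \<longrightarrow> \<not> agree (fst v) x (fst (w U)))" for x
    proof -
      obtain y where y: "agree ?J x y" "g y \<noteq> p" using no by auto
      obtain V O' where V: "openin X V" "openin X O'" "p \<in> V" "g y \<in> O'" "disjnt V O'"
        using Hausdorff p y(2) unfolding Hausdorff_space_def by (metis g_in_topspace)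
      obtain F where F: "finite F" "\<And>z. agree F y z \<Longrightarrow> g z \<in> O'"
        by (rule finite_support[OF V(2,4)]) (rule that)
      have "\<not> agree F x (fst (w U))" if U: "U \<in> A" "U \<subseteq> V" for U
      proof
        assume a: "agree F x (fst (w U))"
        \<comment> \<open>The values of \<open>fst (w U)\<close> on \<open>?J\<close> put the image
          of \<open>?z\<close> into \<open>U\<close>, while \<open>?z\<close> stays close enough to
          \<open>y\<close> to be mapped into \<open>O'\<close>.\<close>
        let ?z = "override ?J (fst (w U)) y"
        have "agree (snd (w U)) (fst (w U)) ?z"
          by (rule agree_mono[OF agree_override]) (use U in auto)
        then have "g ?z \<in> V" using w U by blast
        moreover have "agree (F \<inter> ?J) (fst (w U)) y"
          using a y(1) by (auto simp: agree_def)
        then have "g ?z \<in> O'" by (intro F(2) agree_override_right)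
        ultimately show False using V(5) by (auto simp: disjnt_iff)
      qed
      then show ?thesis using F(1) V(1,3) by (intro exI[of _ "(F, V)"]) simp
    qed
    then have "\<exists>v. \<forall>x. finite (fst (v x)) \<and> openin X (snd (v x)) \<and> p \<in> snd (v x) \<and>
        (\<forall>U\<in>A. U \<subseteq> snd (v x) \<longrightarrow> \<not> agree (fst (v x)) x (fst (w U)))"
      by (intro choice) simp
    then obtain v where v: "\<forall>x. finite (fst (v x)) \<and> openin X (snd (v x)) \<and> p \<in> snd (v x) \<and>
        (\<forall>U\<in>A. U \<subseteq> snd (v x) \<longrightarrow> \<not> agree (fst (v x)) x (fst (w U)))" ..
    obtain D where D: "finite D" "\<And>y. \<exists>x\<in>D. agree (fst (v x)) x y"
      by (rule finite_cylinder_subcover[of "\<lambda>x. fst (v x)"]) (use v that in simp_all)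
    have "D \<noteq> {}" using D(2) by blast
    then have "openin X (\<Inter>x\<in>D. snd (v x))" using D(1) v by (intro openin_Inter) auto
    moreover have "p \<in> (\<Inter>x\<in>D. snd (v x))" using v by simp
    ultimately obtain U where U: "U \<in> A" "U \<subseteq> (\<Inter>x\<in>D. snd (v x))"
      using A(1) unfolding local_pi_base_def by blast
    obtain x where "x \<in> D" "agree (fst (v x)) x (fst (w U))" using D(2) by auto
    then show False using v U by blast
  qed
  ultimately show ?thesis by blast
qed

section \<open>Uniform sets of coordinates for constant cubes\<close>

definition separated :: "'i set \<Rightarrow> ('i \<Rightarrow> bool) \<Rightarrow> ('i \<Rightarrow> bool) \<Rightarrow> bool" where
  "separated F x y \<longleftrightarrow> (\<forall>a b. agree F x a \<longrightarrow> agree F y b \<longrightarrow> g a \<noteq> g b)"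

lemma separated_mono: "separated F x y \<Longrightarrow> F \<subseteq> G \<Longrightarrow> separated G x y"
  by (meson separated_def agree_mono)

lemma separated_cong: "\<lbrakk>separated F x y; agree F x x'; agree F y y'\<rbrakk> \<Longrightarrow> separated F x' y'"
  by (meson separated_def agree_trans)

lemma ex_separated:
  assumes "g x \<noteq> g y" shows "\<exists>F. finite F \<and> separated F x y"
proof -
  obtain F where "finite F" "\<And>x' y'. agree F x x' \<Longrightarrow> agree F y y' \<Longrightarrow> g x' \<noteq> g y'"
    by (rule separating_support[OF assms]) (rule that)
  then show ?thesis unfolding separated_def by blast
qed

text \<open>A finite certificate that the fibre of \<open>g x0\<close> contains no cylinder over
  \<open>J\<close>: either \<open>g\<close> takes two values on the cylinder of \<open>x\<close>, or
  \<open>g x\<close> differs from \<open>g x0\<close>. Both are witnessed by finitely many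
  coordinates, uniformly in \<open>x\<close> by compactness.\<close>

lemma nonconstant_support:
  assumes no: "\<And>x. \<exists>y. agree J x y \<and> g y \<noteq> g x0"
  shows "\<exists>F. finite F \<and> (\<forall>x. (\<exists>z z'. agree J x z \<and> agree J x z' \<and> separated F z z') \<or> separated F x0 x)"
    (is "\<exists>F. finite F \<and> (\<forall>x. ?P F x)")
proof (rule uniform_finite_support)
  fix x
  show "\<exists>F. finite F \<and> (\<forall>y. agree F x y \<longrightarrow> ?P F y)"
  proof (cases "\<exists>z. agree J x z \<and> g z \<noteq> g x")
    case True
    then obtain z where z: "agree J x z" "g z \<noteq> g x" by (elim exE conjE) (rule that)
    obtain F where F: "finite F" "separated F z x" using ex_separated[OF z(2)] by (elim exE conjE) (rule that)
    have "?P F y" if y: "agree F x y" for y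
    proof -
      have "agree (F \<inter> J) y z" using y z(1) by (auto simp: agree_def)
      \<comment> \<open>The splice keeps the \<open>J\<close>-values of \<open>y\<close> and agrees
        with \<open>z\<close> on \<open>F\<close>, so the certificate survives the passage from
        \<open>x\<close> to \<open>y\<close>.\<close>
      then have "separated F (override J y z) y"
        by (intro separated_cong[OF F(2) _ y] agree_override_right)
      then show ?thesis by (intro disjI1 exI[of _ "override J y z"] exI[of _ y]) simp
    qed
    then show ?thesis using F(1) by blast
  next
    case False
    then have "g x0 \<noteq> g x" using no[of x] by metis
    then obtain F where F: "finite F" "separated F x0 x"
      using ex_separated[OF \<open>g x0 \<noteq> g x\<close>] by (elim exE conjE) (rule that)
    then have "?P F y" if "agree F x y" for y
      using separated_cong[OF F(2) agree_refl that] by simp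
    then show ?thesis using F(1) by blast
  qed
next
  show "?P F y \<Longrightarrow> F \<subseteq> G \<Longrightarrow> ?P G y" for F G y
    using separated_mono by blast
qed

text \<open>If every small \<open>J\<close> fails, a recursion along the successor cardinal of
  \<open>|L|\<close> records finite certificates of failure for the coordinates used so far. Some
  \<open>y\<close> lies in more than \<open>|L|\<close> of the recorded cylinders, and a cube in the
  fibre of \<open>g y\<close> contradicts a late certificate.\<close>

lemma ex_uniform_constant_cubes:
  fixes L :: "'l set"
  assumes L: "infinite L"
    and cube: "\<And>p. p \<in> topspace X \<Longrightarrow> \<exists>J x. |J| \<le>o |L| \<and> (\<forall>y. agree J x y \<longrightarrow> g y = p)"
  shows "\<exists>J. |J| \<le>o |L| \<and> (\<forall>p\<in>topspace X. \<exists>x. \<forall>y. agree J x y \<longrightarrow> g y = p)"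
proof (rule ccontr)
  assume no: "\<not> ?thesis"
  \<comment> \<open>Proper initial segments of \<open>r\<close> have at most \<open>|L|\<close>
    elements, but its field has more.\<close>
  define r where "r = cardSuc |L|"
  have r: "Card_order r" unfolding r_def by (intro cardSuc_Card_order card_of_Card_order)
  then have wo: "well_order_on (Field r) r" by (simp add: card_order_on_def)
  then have wfr: "wf (r - Id)" by (simp add: well_order_on_def)
  have under_le: "|underS r a| \<le>o |L|" if "a \<in> Field r" for a
    using card_of_underS[OF r that] cardSuc_ordLeq_ordLess[OF card_of_Card_order card_of_Card_order]
    unfolding r_def by blast
  have big: "\<not> |Field r| \<le>o |L|"
  proof
    assume "|Field r| \<le>o |L|"
    then have "r \<le>o |L|"
      using card_of_Field_ordIso[OF r] ordIso_symmetric ordIso_ordLeq_trans by blast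
    moreover have "|L| <o r" unfolding r_def by (intro cardSuc_greater card_of_Card_order)
    ultimately show False using not_ordLess_ordLeq by blast
  qed
  define H where "H f a = (\<Union>b\<in>underS r a. snd (f b))"
    for f :: "'l set \<Rightarrow> ('i \<Rightarrow> bool) \<times> 'i set" and a
  define Q where "Q f a w \<longleftrightarrow> (a \<in> Field r \<longrightarrow> finite (snd w) \<and>
      (\<forall>x. (\<exists>z z'. agree (H f a) x z \<and> agree (H f a) x z' \<and> separated (snd w) z z')
         \<or> separated (snd w) (fst w) x))"
    for f :: "'l set \<Rightarrow> ('i \<Rightarrow> bool) \<times> 'i set" and a w
  have "\<exists>f. \<forall>a. Q f a (f a)"
  proof (rule dependent_wf_choice[OF wfr])
    fix f f' :: "'l set \<Rightarrow> ('i \<Rightarrow> bool) \<times> 'i set" and a :: "'l set" and w :: "('i \<Rightarrow> bool) \<times> 'i set"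
    assume "\<And>b. (b, a) \<in> r - Id \<Longrightarrow> f b = f' b"
    then have "H f a = H f' a" unfolding H_def by (auto simp: underS_def)
    then show "Q f a w = Q f' a w" by (simp add: Q_def)
  next
    fix f :: "'l set \<Rightarrow> ('i \<Rightarrow> bool) \<times> 'i set" and a :: "'l set"
    assume IH: "\<And>b. (b, a) \<in> r - Id \<Longrightarrow> Q f b (f b)"
    show "\<exists>w. Q f a w"
    proof (cases "a \<in> Field r")
      case True
      have "finite (snd (f b))" if "b \<in> underS r a" for b
        using IH[of b] that by (auto simp: Q_def underS_def Field_def)
      then have "|H f a| \<le>o |L|"
        unfolding H_def
        by (intro card_of_UNION_ordLeq_infinite[OF L under_le[OF True]] ballI
            card_of_finite_ordLeq_infinite[OF _ L]) simp
      then obtain p where p: "p \<in> topspace X" "\<And>x. \<exists>y. agree (H f a) x y \<and> g y \<noteq> p"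
        using no by blast
      obtain x0 where "g x0 = p" using p(1) by (rule topspaceE)
      then have "\<exists>y. agree (H f a) x y \<and> g y \<noteq> g x0" for x using p(2) by simp
      then have "\<exists>F. finite F \<and> (\<forall>x. (\<exists>z z'. agree (H f a) x z \<and> agree (H f a) x z' \<and> separated F z z')
          \<or> separated F x0 x)"
        by (rule nonconstant_support)
      then obtain F where F: "finite F" "\<forall>x. (\<exists>z z'. agree (H f a) x z \<and> agree (H f a) x z' \<and> separated F z z')
          \<or> separated F x0 x"
        by (elim exE conjE) (rule that)
      then have "Q f a (x0, F)" by (simp add: Q_def)
      then show ?thesis ..
    qed (simp add: Q_def)
  qed
  then obtain f where "\<forall>a. Q f a (f a)" ..
  then have f: "Q f a (f a)" for a by simp
  have "\<exists>y S'. S' \<subseteq> Field r \<and> \<not> |S'| \<le>o |L| \<and> (\<forall>a\<in>S'. agree (snd (f a)) (fst (f a)) y)"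
    using f by (intro ex_point_in_many_cylinders L big) (simp add: Q_def)
  then obtain y S' where S': "S' \<subseteq> Field r" "\<not> |S'| \<le>o |L|" "\<forall>a\<in>S'. agree (snd (f a)) (fst (f a)) y"
    by (elim exE conjE) (rule that)
  obtain J x where J: "|J| \<le>o |L|" "\<forall>z. agree J x z \<longrightarrow> g z = g y"
    using cube[OF g_in_topspace[of y]] by (elim exE conjE) (rule that)
  let ?J = "J \<inter> (\<Union>a\<in>Field r. snd (f a))"
  have "\<exists>k. \<forall>j\<in>?J. k j \<in> Field r \<and> j \<in> snd (f (k j))" by (intro bchoice) blast
  then obtain k where k: "\<forall>j\<in>?J. k j \<in> Field r \<and> j \<in> snd (f (k j))" ..
  \<comment> \<open>The stages up to \<open>k j\<close> for the relevant \<open>j\<close>; they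
    number at most \<open>|L|\<close>, so \<open>S'\<close> contains a later one.\<close>
  let ?Z = "\<Union>j\<in>?J. insert (k j) (underS r (k j))"
  have "|?J| \<le>o |L|" using J(1) card_of_mono1[of ?J J] ordLeq_transitive by blast
  moreover have "|insert (k j) (underS r (k j))| \<le>o |L|" if "j \<in> ?J" for j
  proof -
    have "|\<Union>B\<in>{{k j}, underS r (k j)}. B| \<le>o |L|"
      using L k that under_le by (intro card_of_UNION_ordLeq_infinite)
        (auto intro: card_of_finite_ordLeq_infinite)
    then show ?thesis by simp
  qed
  ultimately have "|?Z| \<le>o |L|" using L by (intro card_of_UNION_ordLeq_infinite) auto
  then have "\<not> S' \<subseteq> ?Z" using S'(2) card_of_mono1[of S' ?Z] ordLeq_transitive by blast
  then obtain a where a: "a \<in> S'" "a \<notin> ?Z" by (auto simp only: subset_iff not_all not_imp)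
  have aF: "a \<in> Field r" using a(1) S'(1) by auto
  (* the stage a comes after the first appearance of every coordinate of J *)
  have sub: "snd (f a) \<inter> J \<subseteq> H f a"
  proof
    fix j assume "j \<in> snd (f a) \<inter> J"
    then have j: "j \<in> ?J" using aF by auto
    then have kj: "k j \<in> Field r" "j \<in> snd (f (k j))" using k by auto
    have "a \<noteq> k j" "a \<notin> underS r (k j)" using a(2) j by auto
    moreover have "(a, k j) \<in> r \<or> (k j, a) \<in> r"
      using wo aF kj(1) \<open>a \<noteq> k j\<close> by (auto simp: well_order_on_def linear_order_on_def total_on_def)
    ultimately have "k j \<in> underS r a" by (auto simp: underS_def)
    then show "j \<in> H f a" using kj(2) by (auto simp: H_def)
  qed
  \<comment> \<open>Imposing the values of \<open>x\<close> on \<open>J\<close> changes no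
    coordinate in \<open>snd (f a)\<close>, but moves the point into the fibre of
    \<open>g y\<close>.\<close>
  have move: "agree (snd (f a)) z (override J x z)" "g (override J x z) = g y"
    if "agree (H f a) x z" for z
    using J(2) agree_mono[OF that sub] by (auto intro: agree_override_right)
  from f[of a] aF consider z z' where "agree (H f a) x z" "agree (H f a) x z'" "separated (snd (f a)) z z'"
    | "separated (snd (f a)) (fst (f a)) x"
    unfolding Q_def by blast
  then show False
  proof cases
    case 1
    then show False using move unfolding separated_def by metis
  next
    case 2
    then have "g y \<noteq> g x" using S'(3) a(1) agree_refl unfolding separated_def by blast
    then show False using J(2) agree_refl by metis
  qed
qed

text \<open>On the set \<open>T\<close> of points whose \<open>J\<close>-cylinder is mapped to one
  point, \<open>g\<close> is still onto and depends only on the coordinates in \<open>J\<close>. The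
  base comes from clopen sets \<open>e\<close> supported in \<open>J\<close>, through the points
  whose preimages in \<open>T\<close> lie inside \<open>e\<close>.\<close>

lemma ex_small_base:
  assumes L: "infinite L" and J: "|J| \<le>o |L|"
    and cubes: "\<And>p. p \<in> topspace X \<Longrightarrow> \<exists>x. \<forall>y. agree J x y \<longrightarrow> g y = p"
  shows "\<exists>B. is_base X B \<and> |B| \<le>o |L|"
proof -
  define T where "T = {x. \<forall>y. agree J x y \<longrightarrow> g y = g x}"
  let ?E = "{e. \<exists>G. G \<subseteq> J \<and> finite G \<and> saturated G e}"
  define b where "b e = topspace X - g ` (T - e)" for e
  have T_onto: "\<exists>x\<in>T. g x = p" if p: "p \<in> topspace X" for p
  proof -
    obtain x where x: "\<forall>y. agree J x y \<longrightarrow> g y = p" using cubes[OF p] ..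
    then have "g x = p" by simp
    then show ?thesis using x by (intro bexI[of _ x]) (auto simp: T_def)
  qed
  have b_open: "openin X (b e)" if e: "e \<in> ?E" for e
  proof -
    obtain G where G: "finite G" "saturated G e" using e by auto
    \<comment> \<open>Two values on a \<open>J\<close>-cylinder are separated by finitely many
      coordinates, so \<open>T\<close> is closed; removing the clopen \<open>e\<close> keeps it
      closed, hence compact.\<close>
    have "openin (cantor_cube UNIV) (UNIV - (T - e))"
      unfolding openin_cantor_cube_UNIV
    proof
      fix x assume x: "x \<in> UNIV - (T - e)"
      show "\<exists>F. finite F \<and> (\<forall>y. agree F x y \<longrightarrow> y \<in> UNIV - (T - e))"
      proof (cases "x \<in> e")
        case True
        then have "y \<in> e" if "agree G x y" for y using G(2) that unfolding saturated_def by blast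
        then show ?thesis using G(1) by blast
      next
        case False
        then have "x \<notin> T" using x by blast
        then obtain z where z: "agree J x z" "g z \<noteq> g x" unfolding T_def by blast
        obtain F where F: "finite F" "separated F z x" using ex_separated[OF z(2)] by (elim exE conjE) (rule that)
        have "y \<notin> T" if y: "agree F x y" for y
        proof -
          have "agree (F \<inter> J) y z" using y z(1) by (auto simp: agree_def)
          then have "g (override J y z) \<noteq> g y"
            using F(2) y agree_override_right unfolding separated_def by blast
          then show ?thesis using agree_override[of J y z] unfolding T_def by blast
        qed
        then show ?thesis using F(1) by blast
      qed
    qed
    then have "closedin (cantor_cube UNIV) (T - e)" by (simp add: closedin_def)
    then have "compactin (cantor_cube UNIV) (T - e)"
      using compact_space_cantor_cube closedin_compact_space by blast
    then have "compactin X (g ` (T - e))" using continuous by (rule image_compactin)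
    then have "closedin X (g ` (T - e))" using Hausdorff compactin_imp_closedin by blast
    then show ?thesis unfolding b_def by (intro openin_diff openin_topspace)
  qed
  have "\<exists>W\<in>b ` ?E. p \<in> W \<and> W \<subseteq> V" if V: "openin X V" "p \<in> V" for V p
  proof -
    obtain U where U: "openin X U" "p \<in> U" "X closure_of U \<subseteq> V" by (rule shrink_point[OF V]) (rule that)
    obtain F where F: "finite F" "\<And>x y. agree F x y \<Longrightarrow> g x \<in> U \<Longrightarrow> g y \<in> V"
      by (rule closure_support[OF U(1) V(1) U(3)]) (rule that)
    \<comment> \<open>The smallest set supported by \<open>F \<inter> J\<close> that contains the
      fibre of \<open>p\<close> in \<open>T\<close>; thus \<open>p\<close> lies in
      \<open>b ?e\<close>. For the inclusion in \<open>V\<close>, the \<open>J\<close>-values of a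
      point over \<open>q\<close> are spliced into a point over \<open>p\<close>.\<close>
    let ?e = "{y. \<exists>x\<in>T. g x = p \<and> agree (F \<inter> J) x y}"
    have "saturated (F \<inter> J) ?e" unfolding saturated_def using agree_trans by blast
    then have "?e \<in> ?E" using F(1) by blast
    moreover have "p \<in> b ?e"
      using V openin_subset agree_refl unfolding b_def by blast
    moreover have "b ?e \<subseteq> V"
    proof
      fix q assume q: "q \<in> b ?e"
      then obtain z where z: "z \<in> T" "g z = q" using T_onto[of q] by (auto simp: b_def)
      then have "z \<in> ?e" using q unfolding b_def by blast
      then have "\<exists>x\<in>T. g x = p \<and> agree (F \<inter> J) x z" by simp
      then obtain x where x: "x \<in> T" "g x = p" "agree (F \<inter> J) x z"
        by (elim bexE conjE) (rule that)
      have "agree F x (override J z x)" by (rule agree_override_right[OF agree_sym[OF x(3)]])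
      then have "g (override J z x) \<in> V" using F(2) x(2) U(2) by blast
      moreover have "g (override J z x) = g z"
        using z(1) agree_override unfolding T_def by blast
      ultimately show "q \<in> V" using z(2) by simp
    qed
    ultimately show ?thesis by blast
  qed
  then have "is_base X (b ` ?E)" using b_open unfolding is_base_def by blast
  moreover have "|b ` ?E| \<le>o |L|"
    using card_of_image card_of_finitely_saturated_ordLeq[OF L J] by (rule ordLeq_transitive)
  ultimately show ?thesis by blast
qed


section \<open>Local \<pi>-bases and homogeneous spaces\<close>

lemma local_pi_base_homeomorphic_image:
  assumes h: "homeomorphic_map X X h" and p: "p \<in> topspace X" and A: "local_pi_base p A"
  shows "local_pi_base (h p) ((`) h ` A)"
  unfolding local_pi_base_def
proof (intro conjI ballI allI impI)
  fix U assume "U \<in> (`) h ` A"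
  then obtain U' where U': "U' \<in> A" "U = h ` U'" by (rule imageE) 
  then have "openin X U'" "U' \<noteq> {}" using A by (auto simp: local_pi_base_def)
  then show "openin X U" "U \<noteq> {}"
    using U'(2) homeomorphic_imp_open_map[OF h] by (auto simp: open_map_def)
next
  fix V assume V: "openin X V \<and> h p \<in> V"
  have "openin X {x \<in> topspace X. h x \<in> V}"
    using homeomorphic_imp_continuous_map[OF h] V by (intro openin_continuous_map_preimage) auto
  moreover have "p \<in> {x \<in> topspace X. h x \<in> V}" using V p by simp
  ultimately obtain U where "U \<in> A" "U \<subseteq> {x \<in> topspace X. h x \<in> V}"
    using A unfolding local_pi_base_def by meson
  then show "\<exists>W\<in>(`) h ` A. W \<subseteq> V" by (intro bexI[of _ "h ` U"]) auto
qed

text \<open>If \<open>{p}\<close> were not a member, points other than \<open>p\<close> chosen from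
  all members would form a finite closed set, and its complement would be a neighbourhood of
  \<open>p\<close> containing no member.\<close>

lemma finite_local_pi_base_imp_isolated:
  assumes p: "p \<in> topspace X" and A: "local_pi_base p A" "finite A"
  shows "openin X {p}"
proof -
  have "\<exists>x. \<forall>U\<in>A. U \<noteq> {p} \<longrightarrow> x U \<in> U \<and> x U \<noteq> p"
  proof -
    have "\<exists>x. U \<noteq> {p} \<longrightarrow> x \<in> U \<and> x \<noteq> p" if "U \<in> A" for U
      using A(1) that by (auto simp: local_pi_base_def)
    then show ?thesis by (intro bchoice) simp
  qed
  then obtain x where x: "\<forall>U\<in>A. U \<noteq> {p} \<longrightarrow> x U \<in> U \<and> x U \<noteq> p" ..
  let ?D = "x ` {U\<in>A. U \<noteq> {p}}"
  have "U \<subseteq> topspace X" if "U \<in> A" for U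
    using A(1) that openin_subset unfolding local_pi_base_def by blast
  then have "?D \<subseteq> topspace X" using x by blast
  then have "closedin X ?D"
    using A(2) Hausdorff by (intro closedin_Hausdorff_finite) auto
  then have "openin X (topspace X - ?D)" by blast
  moreover have "p \<in> topspace X - ?D" using p x by auto
  ultimately obtain U where U: "U \<in> A" "U \<subseteq> topspace X - ?D"
    using A(1) unfolding local_pi_base_def by meson
  have "U = {p}"
  proof (rule ccontr)
    assume "U \<noteq> {p}"
    then have "x U \<in> U" "x U \<in> ?D" using x U(1) by auto
    then show False using U(2) by blast
  qed
  then show ?thesis using A(1) U(1) by (simp add: local_pi_base_def)
qed

text \<open>By \<open>min\<close> the members of \<open>A\<close> can be avoided near every point.
  Compactness then lets a single stage cover \<open>b\<close> by finitely many sets inside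
  \<open>b'\<close>, so that the family becomes a base.\<close>

lemma op_like_base:
  assumes L: "infinite (L :: 'l set)" and B0: "is_base X B0" "|B0| \<le>o |L|"
    and min: "\<And>p A. \<lbrakk>p \<in> topspace X; |A| <o |L|\<rbrakk> \<Longrightarrow> \<not> local_pi_base p A"
  shows "Nt_eq_omega X"
proof -
  \<comment> \<open>The summand \<open>nat\<close> carries empty tasks and guarantees that the index
    set is infinite.\<close>
  define T where "T = {(b, b'). b \<in> B0 \<and> b' \<in> B0 \<and> X closure_of b \<subseteq> b'} <+> (UNIV :: nat set)"
  define good where "good t \<U> = (case t of Inl (b, b') \<Rightarrow> b \<subseteq> \<Union>\<U> \<and> (\<forall>U\<in>\<U>. U \<subseteq> b') | Inr n \<Rightarrow> True)"
    for t :: "'a set \<times> 'a set + nat" and \<U>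
  have B0_open: "openin X b" if "b \<in> B0" for b using B0(1) that by (simp add: is_base_def)
  have T_inf: "infinite T" unfolding T_def by (simp add: finite_Plus_iff)
  have "|T| \<le>o |L|"
  proof -
    have "|{(b, b'). b \<in> B0 \<and> b' \<in> B0 \<and> X closure_of b \<subseteq> b'}| \<le>o |B0 \<times> B0|"
      by (intro card_of_mono1) auto
    also have "|B0 \<times> B0| \<le>o |L|"
      by (rule card_of_Times_ordLeq_infinite_Field)
        (use L B0(2) in \<open>simp_all add: Field_card_of card_of_card_order_on\<close>)
    finally show ?thesis
      unfolding T_def using L iffD1[OF infinite_iff_card_of_nat L]
      by (intro card_of_Plus_ordLeq_infinite_Field) (simp_all add: Field_card_of card_of_card_order_on)
  qed
  let ?P = "{U. openin X U \<and> U \<noteq> {}}"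
  have "\<exists>B\<subseteq>?P. op_like natLeq B \<and> (\<forall>t\<in>T. \<exists>\<U>\<subseteq>B. good t \<U>)"
  proof (rule op_like_family[OF T_inf])
    fix U assume "U \<in> ?P"
    then obtain p where "openin X U" "p \<in> U" by auto
    then obtain U' where U': "openin X U'" "p \<in> U'" "X closure_of U' \<subseteq> U" by (rule shrink_point)
    then show "\<exists>U'\<in>?P. X closure_of U' \<subseteq> U" by (intro bexI[of _ U']) auto
  next
    fix t A assume t: "t \<in> T" and A: "A \<subseteq> ?P" "|A| <o |T|"
    have A_less: "|A| <o |L|" using A(2) \<open>|T| \<le>o |L|\<close> by (rule ordLess_ordLeq_trans)
    show "\<exists>W. finite W \<and> good t (fst ` W) \<and>
        (\<forall>(U, V)\<in>W. U \<in> ?P \<and> openin X V \<and> X closure_of U \<subseteq> V \<and> (\<forall>a\<in>A. \<not> a \<subseteq> V))"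
    proof (cases t)
      case (Inr n)
      then show ?thesis by (intro exI[of _ "{}"]) (simp add: good_def)
    next
      case (Inl w)
      then obtain b b' where b: "t = Inl (b, b')" "b \<in> B0" "b' \<in> B0" "X closure_of b \<subseteq> b'"
        using t unfolding T_def by auto
      \<comment> \<open>\<open>fst w\<close> is a neighbourhood of \<open>q\<close> that may be
        added, and \<open>snd w\<close> is the slack around it that avoids \<open>A\<close>.\<close>
      have "\<exists>w. q \<in> fst w \<and> openin X (fst w) \<and> openin X (snd w) \<and> X closure_of (fst w) \<subseteq> snd w \<and>
          snd w \<subseteq> b' \<and> (\<forall>a\<in>A. \<not> a \<subseteq> snd w)" if q: "q \<in> X closure_of b" for q
      proof -
        have qX: "q \<in> topspace X" using q closure_of_subset_topspace[of X b] by blast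
        have "\<not> local_pi_base q A" by (rule min[OF qX A_less])
        moreover have "\<forall>U\<in>A. openin X U \<and> U \<noteq> {}" using A(1) by blast
        ultimately have "\<not> (\<forall>V. openin X V \<and> q \<in> V \<longrightarrow> (\<exists>U\<in>A. U \<subseteq> V))"
          unfolding local_pi_base_def by argo
        then have "\<exists>V. openin X V \<and> q \<in> V \<and> (\<forall>a\<in>A. \<not> a \<subseteq> V)"
          by (simp only: not_all not_imp conj_assoc) blast
        then obtain V where V: "openin X V" "q \<in> V" "\<forall>a\<in>A. \<not> a \<subseteq> V"
          by (elim exE conjE) (rule that)
        have "openin X (V \<inter> b')" "q \<in> V \<inter> b'" using V(1,2) B0_open[OF b(3)] b(4) q by auto
        moreover from this obtain U where "openin X U" "q \<in> U" "X closure_of U \<subseteq> V \<inter> b'"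
          by (rule shrink_point)
        ultimately show ?thesis using V(3) by (intro exI[of _ "(U, V \<inter> b')"]) auto
      qed
      then have "\<exists>w. \<forall>q\<in>X closure_of b. q \<in> fst (w q) \<and> openin X (fst (w q)) \<and> openin X (snd (w q)) \<and>
          X closure_of (fst (w q)) \<subseteq> snd (w q) \<and> snd (w q) \<subseteq> b' \<and> (\<forall>a\<in>A. \<not> a \<subseteq> snd (w q))"
        by (intro bchoice) simp
      then obtain w where w: "\<forall>q\<in>X closure_of b. q \<in> fst (w q) \<and> openin X (fst (w q)) \<and>
          openin X (snd (w q)) \<and>
          X closure_of (fst (w q)) \<subseteq> snd (w q) \<and> snd (w q) \<subseteq> b' \<and> (\<forall>a\<in>A. \<not> a \<subseteq> snd (w q))" ..
      have sub: "fst (w q) \<subseteq> snd (w q)" if "q \<in> X closure_of b" for q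
        using w that closure_of_subset[of "fst (w q)" X] openin_subset by blast
      have "compactin X (X closure_of b)" using compact by (intro closedin_compact_space) auto
      moreover have "X closure_of b \<subseteq> \<Union>((\<lambda>q. fst (w q)) ` (X closure_of b))" using w by blast
      ultimately have "\<exists>\<F>. finite \<F> \<and> \<F> \<subseteq> (\<lambda>q. fst (w q)) ` (X closure_of b) \<and> X closure_of b \<subseteq> \<Union>\<F>"
        using w by (intro compactinD) auto
      then obtain \<F> where \<F>: "finite \<F>" "\<F> \<subseteq> (\<lambda>q. fst (w q)) ` (X closure_of b)" "X closure_of b \<subseteq> \<Union>\<F>"
        by (elim exE conjE) (rule that)
      then have "\<exists>D\<subseteq>X closure_of b. finite D \<and> \<F> = (\<lambda>q. fst (w q)) ` D"
        by (intro finite_subset_image)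
      then obtain D where D: "D \<subseteq> X closure_of b" "finite D" "\<F> = (\<lambda>q. fst (w q)) ` D"
        by (elim exE conjE) (rule that)
      have "b \<subseteq> X closure_of b"
        using B0_open[OF b(2)] by (intro closure_of_subset openin_subset)
      then have "b \<subseteq> \<Union>(fst ` w ` D)" using \<F>(3) D(3) by (simp add: image_image)
      moreover have "fst (w q) \<subseteq> b'" if "q \<in> D" for q
      proof -
        have "q \<in> X closure_of b" using that D(1) by blast
        then show ?thesis using w sub by (meson order_trans)
      qed
      ultimately have "good t (fst ` w ` D)" unfolding good_def b(1) by simp
      moreover have "\<forall>(U, V)\<in>w ` D. U \<in> ?P \<and> openin X V \<and> X closure_of U \<subseteq> V \<and> (\<forall>a\<in>A. \<not> a \<subseteq> V)"
      proof
        fix v assume "v \<in> w ` D"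
        then obtain q where "q \<in> X closure_of b" "v = w q" using D(1) by auto
        then show "case v of (U, V) \<Rightarrow> U \<in> ?P \<and> openin X V \<and> X closure_of U \<subseteq> V \<and> (\<forall>a\<in>A. \<not> a \<subseteq> V)"
          using w by (auto simp: split_beta)
      qed
      ultimately show ?thesis using D(2) by (intro exI[of _ "w ` D"]) simp
    qed
  qed simp
  then obtain B where B: "B \<subseteq> ?P" "op_like natLeq B" "\<forall>t\<in>T. \<exists>\<U>\<subseteq>B. good t \<U>"
    by (elim exE conjE) (rule that)
  have "\<exists>W\<in>B. p \<in> W \<and> W \<subseteq> V" if V: "openin X V" "p \<in> V" for V p
  proof -
    have base: "\<exists>b\<in>B0. p \<in> b \<and> b \<subseteq> U" if "openin X U" "p \<in> U" for U
      using B0(1) that by (simp add: is_base_def)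
    obtain b' where b': "b' \<in> B0" "p \<in> b'" "b' \<subseteq> V" using base[OF V] by auto
    obtain U where U: "openin X U" "p \<in> U" "X closure_of U \<subseteq> b'"
      by (rule shrink_point[OF B0_open[OF b'(1)] b'(2)]) (rule that)
    obtain b where b: "b \<in> B0" "p \<in> b" "b \<subseteq> U" using base[OF U(1,2)] by auto
    have "X closure_of b \<subseteq> b'" using closure_of_mono[OF b(3)] U(3) by blast
    then have "Inl (b, b') \<in> T" using b(1) b'(1) by (simp add: T_def InlI)
    then have "\<exists>\<U>\<subseteq>B. good (Inl (b, b')) \<U>" using B(3) by blast
    then obtain \<U> where "\<U> \<subseteq> B" "b \<subseteq> \<Union>\<U>" "\<forall>U\<in>\<U>. U \<subseteq> b'"
      by (auto simp: good_def)
    then show ?thesis using b(2) b'(3) by (meson UnionE order_trans subsetD)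
  qed
  then have "is_base X B" using B(1) by (auto simp: is_base_def)
  then show ?thesis using B(2) unfolding Nt_eq_omega_def by blast
qed

text \<open>Homeomorphisms carry a local \<pi>-base of least size to every point, so its cardinality
  is the \<pi>-character everywhere; constant cubes show that it also bounds the weight.\<close>

lemma homogeneous_Nt_eq_omega:
  assumes hom: "homogeneous_space X"
  shows "Nt_eq_omega X"
proof (cases "topspace X = {}")
  case True
  then have "U = {}" if "openin X U" for U using openin_subset[OF that] by simp
  then have "is_base X {}" by (auto simp: is_base_def)
  then show ?thesis unfolding Nt_eq_omega_def op_like_natLeq by blast
next
  case False
  let ?Q = "\<lambda>A. \<exists>p\<in>topspace X. local_pi_base p A"
  obtain p0 where "p0 \<in> topspace X" using False by blast
  moreover have "local_pi_base p0 {U. openin X U \<and> U \<noteq> {}}" by (auto simp: local_pi_base_def)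
  ultimately have "?Q {U. openin X U \<and> U \<noteq> {}}" by blast
  from ex_minimal_card[of ?Q, OF this] obtain A where A: "?Q A \<and> (\<forall>C. ?Q C \<longrightarrow> |A| \<le>o |C| )" ..
  then obtain p where p: "p \<in> topspace X" "local_pi_base p A" by (elim conjE bexE) (rule that)
  have min: "\<not> local_pi_base q C" if "q \<in> topspace X" "|C| <o |A|" for q C
    using A that not_ordLess_ordLeq by blast
  have "\<exists>h. homeomorphic_map X X h \<and> h p = q" if "q \<in> topspace X" for q
    using hom p(1) that by (simp add: homogeneous_space_def)
  then have everywhere: "\<exists>h. local_pi_base q ((`) h ` A)" if "q \<in> topspace X" for q
    using local_pi_base_homeomorphic_image[OF _ p] that by metis
  show ?thesis
  proof (cases "finite A")
    \<comment> \<open>Finite \<pi>-character makes every point isolated, and the singletons form a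
      base.\<close>
    case True
    have "openin X {q}" if q: "q \<in> topspace X" for q
      using everywhere[OF q] finite_local_pi_base_imp_isolated[OF q] True by blast
    then have "is_base X ((\<lambda>q. {q}) ` topspace X)"
      using openin_subset by (fastforce simp: is_base_def)
    moreover have "op_like natLeq ((\<lambda>q. {q}) ` topspace X)"
      unfolding op_like_natLeq
    proof
      fix s assume "s \<in> (\<lambda>q. {q}) ` topspace X"
      then have "{t \<in> (\<lambda>q. {q}) ` topspace X. s \<subseteq> t} \<subseteq> {s}" by auto
      then show "finite {t \<in> (\<lambda>q. {q}) ` topspace X. s \<subseteq> t}" using finite_subset by blast
    qed
    ultimately show ?thesis unfolding Nt_eq_omega_def by blast
  next
    case False
    have "\<exists>J x. |J| \<le>o |A| \<and> (\<forall>y. agree J x y \<longrightarrow> g y = q)" if q: "q \<in> topspace X" for q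
    proof -
      obtain h where "local_pi_base q ((`) h ` A)" using everywhere[OF q] ..
      then show ?thesis using ex_constant_cube[OF q _ card_of_image False] by simp
    qed
    then have "\<exists>J. |J| \<le>o |A| \<and> (\<forall>q\<in>topspace X. \<exists>x. \<forall>y. agree J x y \<longrightarrow> g y = q)"
      by (rule ex_uniform_constant_cubes[OF False])
    then obtain J where J: "|J| \<le>o |A|" "\<forall>q\<in>topspace X. \<exists>x. \<forall>y. agree J x y \<longrightarrow> g y = q"
      by (elim exE conjE) (rule that)
    have "\<exists>B. is_base X B \<and> |B| \<le>o |A|"
      by (rule ex_small_base[OF False J(1)]) (use J(2) in simp)
    then obtain B where B: "is_base X B" "|B| \<le>o |A|" by (elim exE conjE) (rule that)
    show ?thesis by (rule op_like_base[OF False B min])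
  qed
qed

end

text \<open>The points of \<open>cantor_cube I\<close> are extensional functions, so restriction to
  \<open>I\<close> maps the full cube onto it.\<close>

lemma dyadic_map_of_dyadic_compactum:
  fixes X :: "'a topology" and I :: "'i set" and f :: "('i \<Rightarrow> bool) \<Rightarrow> 'a"
  assumes "dyadic_compactum_via I f X"
  shows "dyadic_map X (\<lambda>x. f (restrict x I))"
proof
  have f: "continuous_map (cantor_cube I) X f" "f ` topspace (cantor_cube I) = topspace X"
    using assms by (auto simp: dyadic_compactum_via_def)
  show "compact_space X" "Hausdorff_space X" using assms by (auto simp: dyadic_compactum_via_def)
  have "continuous_map (cantor_cube UNIV) (cantor_cube I) (\<lambda>x. restrict x I)"
    unfolding cantor_cube_def continuous_map_componentwise
    by (auto intro: continuous_map_product_projection)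
  from continuous_map_compose[OF this f(1)]
  show "continuous_map (cantor_cube UNIV) X (\<lambda>x. f (restrict x I))" by (simp add: o_def)
  have "topspace (cantor_cube I) = range (\<lambda>x. restrict x I)"
    unfolding cantor_cube_def by (auto simp: image_iff PiE_iff) (metis extensional_restrict)
  then show "range (\<lambda>x. f (restrict x I)) = topspace X" using f(2) by (metis image_image)
qed

theorem theorem1p5:
  fixes X :: "'a topology" and I :: "'i set" and f :: "('i \<Rightarrow> bool) \<Rightarrow> 'a"
  assumes "dyadic_compactum_via I f X"
  shows "piNt_eq_omega X \<and> chiKNt_eq_omega X \<and> (homogeneous_space X \<longrightarrow> Nt_eq_omega X)"
proof -
  interpret dyadic_map X "\<lambda>x. f (restrict x I)"
    using assms by (rule dyadic_map_of_dyadic_compactum)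
  \<comment> \<open>Compact sets are closed in a Hausdorff space, so the result for closed sets
    covers \<open>chiKNt_eq_omega\<close>.\<close>
  show ?thesis
    using piNt_eq_omega homogeneous_Nt_eq_omega chiNt_eq_omega_closed
      compactin_imp_closedin[OF Hausdorff] unfolding chiKNt_eq_omega_def by blast
qed

end
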